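(* Let $D_H$ be a weighted oriented graph whose underlying graph $H$ is the $5$-cycle $C_5$. Then $I(D_H)$ is Cohen-Macaulay if and only if either $D_H\simeq D_4$, or there is an edge $(x,y)\in E(D_H)$ with $w(x)=w(y)=1$ and $D_H$ is not isomorphic to any graph of type $D_1$, $D_2$ or $D_3$. Here, writing the cycle as $x_1x_2x_3x_4x_5x_1$ (edges $\{x_1,x_2\},\{x_2,x_3\},\{x_3,x_4\},\{x_4,x_5\},\{x_5,x_1\}$), and with edges not listed as oriented allowed to have either orientation: $D_1$: $(x_4,x_3),(x_4,x_5),(x_3,x_2),(x_5,x_1)\in E$, $w(x_1)=w(x_2)=w(x_4)=1$, $w(x_3)\neq1$, $w(x_5)\ne 1$; $D_2$: $(x_4,x_3),(x_5,x_4),(x_1,x_5)\in E$, $w(x_1)=w(x_2)=w(x_3)=1$, $w(x_4)\ne1$, $w(x_5)\ne1$; $D_3$: $(x_4,x_3),(x_5,x_4),(x_1,x_5)\in E$, $w(x_1)=w(x_2)=1$, $w(x_3)\ne1$, $w(x_4)\ne1$, $w(x_5)\ne1$; $D_4$: $(x_4,x_3),(x_4,x_5),(x_2,x_3),(x_1,x_2)\in E$, $w(x_1)=w(x_4)=1$, $w(x_2)\ne1$, $w(x_3)\ne1$, $w(x_5)\ne1$.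
   Context: A weighted oriented graph $D$ with underlying simple graph on vertices $x_1,\ldots,x_n$ is an orientation of its edges with a weight function $w:V\to\mathbb{Z}_{>0}$; an edge oriented from $x_i$ to $x_j$ is written $(x_i,x_j)$. By convention, a source is assigned weight $1$. The edge ideal is $I(D)=\langle x_ix_j^{w(x_j)}:(x_i,x_j)\in E(D)\rangle\subseteq A=K[x_1,\ldots,x_n]$, $K$ a field; $I(D)$ is Cohen-Macaulay if $A/I(D)$ is Cohen-Macaulay. Isomorphism $\simeq$ of weighted oriented graphs means a graph isomorphism preserving orientations and weights. *)

theory Defs
  imports "HOL-Library.Poly_Mapping" "HOL-Library.Numeral_Type" "HOL-Library.Extended_Nat"
begin

definition is_ideal :: "'a::comm_ring_1 set \<Rightarrow> bool" where
  "is_ideal I \<longleftrightarrow> 0 \<in> I \<and> (\<forall>a\<in>I. \<forall>b\<in>I. a + b \<in> I) \<and> (\<forall>r. \<forall>a\<in>I. r * a \<in> I)"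

definition ideal_gen :: "'a::comm_ring_1 set \<Rightarrow> 'a set" where
  "ideal_gen S = \<Inter> {I. is_ideal I \<and> S \<subseteq> I}"

definition is_prime_ideal :: "'a::comm_ring_1 set \<Rightarrow> bool" where
  "is_prime_ideal P \<longleftrightarrow> is_ideal P \<and> P \<noteq> UNIV \<and> (\<forall>a b. a * b \<in> P \<longrightarrow> a \<in> P \<or> b \<in> P)"

definition krull_dim_quot :: "'a::comm_ring_1 set \<Rightarrow> enat" where
  "krull_dim_quot I = Sup {enat n | n. \<exists>P :: nat \<Rightarrow> 'a set.
      (\<forall>i\<le>n. is_prime_ideal (P i) \<and> I \<subseteq> P i) \<and> (\<forall>i<n. P i \<subset> P (Suc i))}"

definition regular_seq_quot :: "'a::comm_ring_1 set \<Rightarrow> 'a set \<Rightarrow> 'a list \<Rightarrow> bool" where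
  "regular_seq_quot M I fs \<longleftrightarrow> set fs \<subseteq> M \<and>
     ideal_gen (I \<union> set fs) \<noteq> UNIV \<and>
     (\<forall>i < length fs. \<forall>g. fs ! i * g \<in> ideal_gen (I \<union> set (take i fs))
                          \<longrightarrow> g \<in> ideal_gen (I \<union> set (take i fs)))"

definition depth_quot :: "'a::comm_ring_1 set \<Rightarrow> 'a set \<Rightarrow> enat" where
  "depth_quot M I = Sup {enat (length fs) | fs. regular_seq_quot M I fs}"

text \<open>Variables are indexed by the 5-element type \<open>5\<close>; the vertex x_k of the paper
  corresponds to the element k-1 of type \<open>5\<close> (arithmetic mod 5).
  Polynomials are finitely supported maps from monomials (exponent vectors) to K.\<close>
type_synonym 'k pol5 = "(5 \<Rightarrow>\<^sub>0 nat) \<Rightarrow>\<^sub>0 'k"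

definition var :: "5 \<Rightarrow> 'k::field pol5" where
  "var i = Poly_Mapping.single (Poly_Mapping.single i 1) 1"

definition max_ideal :: "'k::field pol5 set" where
  "max_ideal = ideal_gen (range var)"

text \<open>A/I is Cohen-Macaulay (graded setting): depth_m(A/I) = dim(A/I).\<close>
definition cohen_macaulay_quot :: "'k::field pol5 set \<Rightarrow> bool" where
  "cohen_macaulay_quot I \<longleftrightarrow> depth_quot max_ideal I = krull_dim_quot I"

definition edge_ideal :: "(5 \<times> 5) set \<Rightarrow> (5 \<Rightarrow> nat) \<Rightarrow> 'k::field pol5 set" where
  "edge_ideal E w = ideal_gen {var i * var j ^ w j | i j. (i, j) \<in> E}"

definition is_source :: "(5 \<times> 5) set \<Rightarrow> 5 \<Rightarrow> bool" where
  "is_source E v \<longleftrightarrow> (\<nexists>u. (u, v) \<in> E)"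

definition weighted_oriented_C5 :: "(5 \<times> 5) set \<Rightarrow> (5 \<Rightarrow> nat) \<Rightarrow> bool" where
  "weighted_oriented_C5 E w \<longleftrightarrow>
     (\<exists>\<sigma> :: 5 \<Rightarrow> 5. bij \<sigma> \<and> (\<forall>a b. ((a, b) \<in> E \<or> (b, a) \<in> E) \<longleftrightarrow> (\<exists>i. {a, b} = {\<sigma> i, \<sigma> (i + 1)}))) \<and>
     (\<forall>a b. (a, b) \<in> E \<longrightarrow> (b, a) \<notin> E) \<and>
     (\<forall>v. w v > 0) \<and> (\<forall>v. is_source E v \<longrightarrow> w v = 1)"

definition std_C5_orientation :: "(5 \<times> 5) set \<Rightarrow> bool" where
  "std_C5_orientation E \<longleftrightarrow>
     (\<forall>a b. ((a, b) \<in> E \<or> (b, a) \<in> E) \<longleftrightarrow> (b = a + 1 \<or> a = b + 1)) \<and>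
     (\<forall>a b. (a, b) \<in> E \<longrightarrow> (b, a) \<notin> E)"

definition wog_iso :: "(5 \<times> 5) set \<Rightarrow> (5 \<Rightarrow> nat) \<Rightarrow> (5 \<times> 5) set \<Rightarrow> (5 \<Rightarrow> nat) \<Rightarrow> bool" where
  "wog_iso E w E' w' \<longleftrightarrow> (\<exists>f. bij f \<and> (\<forall>a b. (a, b) \<in> E \<longleftrightarrow> (f a, f b) \<in> E') \<and> (\<forall>v. w' (f v) = w v))"

(* x1 = 0, x2 = 1, x3 = 2, x4 = 3, x5 = 4 *)
definition typeD1 :: "(5 \<times> 5) set \<Rightarrow> (5 \<Rightarrow> nat) \<Rightarrow> bool" where
  "typeD1 E w \<longleftrightarrow> std_C5_orientation E \<and>
     (3, 2) \<in> E \<and> (3, 4) \<in> E \<and> (2, 1) \<in> E \<and> (4, 0) \<in> E \<and>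
     w 0 = 1 \<and> w 1 = 1 \<and> w 3 = 1 \<and> w 2 \<noteq> 1 \<and> w 4 \<noteq> 1"

definition typeD2 :: "(5 \<times> 5) set \<Rightarrow> (5 \<Rightarrow> nat) \<Rightarrow> bool" where
  "typeD2 E w \<longleftrightarrow> std_C5_orientation E \<and>
     (3, 2) \<in> E \<and> (4, 3) \<in> E \<and> (0, 4) \<in> E \<and>
     w 0 = 1 \<and> w 1 = 1 \<and> w 2 = 1 \<and> w 3 \<noteq> 1 \<and> w 4 \<noteq> 1"

definition typeD3 :: "(5 \<times> 5) set \<Rightarrow> (5 \<Rightarrow> nat) \<Rightarrow> bool" where
  "typeD3 E w \<longleftrightarrow> std_C5_orientation E \<and>
     (3, 2) \<in> E \<and> (4, 3) \<in> E \<and> (0, 4) \<in> E \<and>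
     w 0 = 1 \<and> w 1 = 1 \<and> w 2 \<noteq> 1 \<and> w 3 \<noteq> 1 \<and> w 4 \<noteq> 1"

definition typeD4 :: "(5 \<times> 5) set \<Rightarrow> (5 \<Rightarrow> nat) \<Rightarrow> bool" where
  "typeD4 E w \<longleftrightarrow> std_C5_orientation E \<and>
     (3, 2) \<in> E \<and> (3, 4) \<in> E \<and> (1, 2) \<in> E \<and> (0, 1) \<in> E \<and>
     w 0 = 1 \<and> w 3 = 1 \<and> w 1 \<noteq> 1 \<and> w 2 \<noteq> 1 \<and> w 4 \<noteq> 1"

definition iso_to_type :: "((5 \<times> 5) set \<Rightarrow> (5 \<Rightarrow> nat) \<Rightarrow> bool) \<Rightarrow> (5 \<times> 5) set \<Rightarrow> (5 \<Rightarrow> nat) \<Rightarrow> bool" where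
  "iso_to_type T E w \<longleftrightarrow> (\<exists>E' w'. T E' w' \<and> wog_iso E w E' w')"

end

theory Submission
  imports Defs "HOL-Library.FuncSet"
begin

text \<open>The dimension of \<open>A/I(D)\<close> is two, so \<open>I(D)\<close> is Cohen-Macaulay iff the depth is at least two.
  A regular sequence of length two forces the zeroth and first Koszul cohomology of \<open>A/I(D)\<close> with
  respect to the variables to vanish; conversely, if they vanish, the polynomials
  \<open>\<Sum> x\<^sub>i\<close> and \<open>\<Sum> x\<^sub>i x\<^bsub>i+2\<^esub>\<close> (sums along the cycle), which generate an ideal primary
  to the maximal one modulo \<open>I(D)\<close>, form a regular sequence.
  As \<open>I(D)\<close> is a monomial ideal, the vanishing can be tested one monomial \<open>x\<^sup>a\<close> at a time, and the
  test only involves, for each vertex, the truth of \<open>1 \<le> a\<close>, \<open>w \<le> a\<close> and \<open>w \<le> a + 1\<close>.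
  This leaves a propositional problem about the orientation and the set of vertices of weight one.\<close>

section \<open>Ideals and monomial ideals\<close>

text \<open>The field \<open>'k\<close> is arbitrary and may be finite, so generic linear forms are
  not at hand for building a regular sequence. The two explicit polynomials replace them: modulo
  products of adjacent variables they are the first two elementary symmetric polynomials, and they
  are parameters over every field because among any three vertices of a pentagon two are adjacent.
  The bounds depth at most 2 and dimension at most 2 come from one source. Only O(B^2) monomials
  with exponents up to B lie outside the ideal, whereas three polynomials have cubically many
  products of powers; linear algebra gives a relation f1^l (f2^m (f3^n (r + f3 p) + f2 q) + f1 s) in
  I(D) with a nonzero constant r. This is the shape of the Coquand-Lombardi criterion for Krull
  dimension. Cancelling the powers of f1, f2, f3 in turn rules out both a chain of four primes and a
  regular sequence of length three, so the two bounds are obtained side by side without comparing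
  depth and dimension in general.\<close>

lemma is_idealD:
  assumes "is_ideal I"
  shows "0 \<in> I" "a \<in> I \<Longrightarrow> b \<in> I \<Longrightarrow> a + b \<in> I" "a \<in> I \<Longrightarrow> r * a \<in> I" "a \<in> I \<Longrightarrow> a * r \<in> I"
    "a \<in> I \<Longrightarrow> - a \<in> I" "a \<in> I \<Longrightarrow> b \<in> I \<Longrightarrow> a - b \<in> I"
proof -
  show 1: "0 \<in> I" and 2: "a \<in> I \<Longrightarrow> b \<in> I \<Longrightarrow> a + b \<in> I" and 3: "a \<in> I \<Longrightarrow> r * a \<in> I" for a b r
    using assms by (auto simp: is_ideal_def)
  show "a \<in> I \<Longrightarrow> a * r \<in> I" using 3[of a r] by (simp add: mult.commute)
  show 4: "a \<in> I \<Longrightarrow> - a \<in> I" for a using 3[of a "-1"] by simp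
  show "a \<in> I \<Longrightarrow> b \<in> I \<Longrightarrow> a - b \<in> I" using 2[of a "- b"] 4[of b] by simp
qed

lemma is_ideal_sum:
  assumes "is_ideal I" "\<And>x. x \<in> A \<Longrightarrow> f x \<in> I"
  shows "sum f A \<in> I"
  using assms(2) by (induction A rule: infinite_finite_induct) (auto intro: is_idealD[OF assms(1)])

lemma is_ideal_ideal_gen: "is_ideal (ideal_gen S)"
  unfolding is_ideal_def ideal_gen_def by blast

lemma ideal_gen_superset: "S \<subseteq> ideal_gen S"
  unfolding ideal_gen_def by blast

lemma ideal_gen_minimal: "is_ideal I \<Longrightarrow> S \<subseteq> I \<Longrightarrow> ideal_gen S \<subseteq> I"
  unfolding ideal_gen_def by blast

lemma ideal_gen_eq: "is_ideal I \<Longrightarrow> ideal_gen I = I"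
  by (simp add: ideal_gen_minimal ideal_gen_superset subset_antisym)

lemma ideal_UNIV_iff: "is_ideal I \<Longrightarrow> I = UNIV \<longleftrightarrow> 1 \<in> I"
  using is_idealD(3)[of I 1] by auto

lemma mem_ideal_gen_insert:
  "x \<in> ideal_gen (insert f S) \<longleftrightarrow> (\<exists>r. x - r * f \<in> ideal_gen S)"
proof -
  let ?J = "{x. \<exists>r. x - r * f \<in> ideal_gen S}"
  note I = is_idealD[OF is_ideal_ideal_gen[of S]]
  have "is_ideal ?J"
    unfolding is_ideal_def
  proof (intro conjI ballI allI)
    show "0 \<in> ?J" using I(1) by (auto intro!: exI[of _ 0])
  next
    fix a b assume "a \<in> ?J" "b \<in> ?J"
    then obtain r s where "a - r * f \<in> ideal_gen S" "b - s * f \<in> ideal_gen S" by blast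
    from I(2)[OF this] show "a + b \<in> ?J"
      by (auto intro!: exI[of _ "r + s"] simp: algebra_simps)
  next
    fix q a assume "a \<in> ?J"
    then obtain r where "a - r * f \<in> ideal_gen S" by blast
    from I(3)[OF this, of q] show "q * a \<in> ?J"
      by (auto intro!: exI[of _ "q * r"] simp: algebra_simps)
  qed
  moreover have "insert f S \<subseteq> ?J"
    using I(1) ideal_gen_superset[of S] exI[of "\<lambda>r. _ - r * f \<in> ideal_gen S" 0]
    by (auto intro: exI[of _ 1])
  ultimately have "ideal_gen (insert f S) \<subseteq> ?J" by (rule ideal_gen_minimal)
  moreover have "?J \<subseteq> ideal_gen (insert f S)"
  proof
    fix x assume "x \<in> ?J"
    then obtain r where r: "x - r * f \<in> ideal_gen S" by blast
    have "ideal_gen S \<subseteq> ideal_gen (insert f S)" by (auto simp: ideal_gen_def)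
    moreover have "r * f \<in> ideal_gen (insert f S)"
      using ideal_gen_superset is_idealD(3)[OF is_ideal_ideal_gen] by blast
    ultimately show "x \<in> ideal_gen (insert f S)"
      using is_idealD(2)[OF is_ideal_ideal_gen, of "x - r * f" "insert f S" "r * f"] r by auto
  qed
  ultimately show ?thesis by auto
qed

lemma mem_ideal_gen_range:
  fixes x :: "'n::finite \<Rightarrow> 'a::comm_ring_1"
  shows "f \<in> ideal_gen (range x) \<longleftrightarrow> (\<exists>c. f = (\<Sum>i\<in>UNIV. c i * x i))"
proof -
  let ?J = "{f. \<exists>c. f = (\<Sum>i\<in>UNIV. c i * x i)}"
  have "is_ideal ?J"
    unfolding is_ideal_def
  proof (intro conjI ballI allI)
    show "0 \<in> ?J" by (auto intro!: exI[of _ "\<lambda>_. 0"])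
  next
    fix a b assume "a \<in> ?J" "b \<in> ?J"
    then obtain c d where "a = (\<Sum>i\<in>UNIV. c i * x i)" "b = (\<Sum>i\<in>UNIV. d i * x i)" by blast
    then show "a + b \<in> ?J"
      by (auto intro!: exI[of _ "\<lambda>i. c i + d i"] simp: sum.distrib distrib_right)
  next
    fix q a assume "a \<in> ?J"
    then obtain c where "a = (\<Sum>i\<in>UNIV. c i * x i)" by blast
    then show "q * a \<in> ?J"
      by (auto intro!: exI[of _ "\<lambda>i. q * c i"] simp: sum_distrib_left mult.assoc)
  qed
  moreover have "range x \<subseteq> ?J"
  proof
    fix y assume "y \<in> range x"
    then obtain j where "y = x j" by blast
    then have "y = (\<Sum>i\<in>UNIV. (if i = j then 1 else 0) * x i)"
      by (simp add: if_distrib[of "\<lambda>c. c * _"] cong: if_cong)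
    then show "y \<in> ?J" by (auto intro: exI[of _ "\<lambda>i. if i = j then 1 else 0"])
  qed
  ultimately have "ideal_gen (range x) \<subseteq> ?J" by (rule ideal_gen_minimal)
  moreover have "(\<Sum>i\<in>UNIV. c i * x i) \<in> ideal_gen (range x)" for c
    by (intro is_ideal_sum is_idealD is_ideal_ideal_gen) (use ideal_gen_superset in blast)
  ultimately show ?thesis by auto
qed

text \<open>Every term of the binomial expansion has total exponent \<open>m + n\<close>, so
  \<open>a\<close> occurs at least \<open>m\<close> times or \<open>b\<close> at least
  \<open>n\<close> times. This makes the radical an ideal.\<close>

lemma radical_add:
  assumes I: "is_ideal I" and a: "a ^ m \<in> I" and b: "b ^ n \<in> I"
  shows "(a + b) ^ (m + n) \<in> I"
  unfolding binomial_ring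
proof (intro is_ideal_sum[OF I])
  fix k
  have "a ^ k * b ^ (m + n - k) \<in> I"
  proof (cases "k \<ge> m")
    case True
    then have "a ^ k = a ^ (k - m) * a ^ m" by (simp flip: power_add)
    then show ?thesis using is_idealD(3,4)[OF I] a by (metis mult.commute)
  next
    case False
    then have "b ^ (m + n - k) = b ^ (m - k) * b ^ n" by (simp flip: power_add)
    then show ?thesis using is_idealD(3)[OF I] b by metis
  qed
  then show "of_nat (m + n choose k) * a ^ k * b ^ (m + n - k) \<in> I"
    using is_idealD(3)[OF I] by (metis mult.assoc)
qed

section \<open>Coefficients of polynomials and ideals spanned by monomials\<close>

abbreviation "lookup \<equiv> Poly_Mapping.lookup"
abbreviation "keys \<equiv> Poly_Mapping.keys"
abbreviation pow :: "'n \<Rightarrow> 'n \<Rightarrow>\<^sub>0 nat" where "pow i \<equiv> Poly_Mapping.single i (Suc 0)"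

lemma lookup_single_mult_add:
  fixes f :: "('n \<Rightarrow>\<^sub>0 nat) \<Rightarrow>\<^sub>0 'k::comm_ring_1"
  shows "lookup (Poly_Mapping.single m c * f) (m + a) = c * lookup f a"
  by (simp add: lookup_mult lookup_single when_mult)

lemma lookup_single_mult_zero:
  fixes f :: "('n \<Rightarrow>\<^sub>0 nat) \<Rightarrow>\<^sub>0 'k::comm_ring_1"
  assumes "\<And>a. b \<noteq> m + a"
  shows "lookup (Poly_Mapping.single m c * f) b = 0"
  using assms by (simp add: lookup_mult lookup_single when_mult)

lemma pow_add_exists:
  fixes b :: "'n \<Rightarrow>\<^sub>0 nat"
  shows "lookup b i \<noteq> 0 \<Longrightarrow> \<exists>a. b = pow i + a"
  by (intro exI[of _ "b - pow i"] poly_mapping_eqI)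
    (auto simp: lookup_add lookup_minus lookup_single when_def)

lemma lookup_var_mult_add [simp]:
  fixes f :: "'k::field pol5"
  shows "lookup (var i * f) (pow i + a) = lookup f a"
  by (simp add: var_def lookup_single_mult_add)

lemma lookup_var_mult_0:
  fixes f :: "'k::field pol5" and b :: "5 \<Rightarrow>\<^sub>0 nat"
  shows "lookup b i = 0 \<Longrightarrow> lookup (var i * f) b = 0"
  unfolding var_def by (rule lookup_single_mult_zero) (auto simp: lookup_add)

lemma poly_mapping_sum_single: "f = (\<Sum>a\<in>keys f. Poly_Mapping.single a (lookup f a))"
  by (rule poly_mapping_eqI) (auto simp: lookup_sum lookup_single when_def in_keys_iff)

definition mono_ideal :: "('n \<Rightarrow>\<^sub>0 nat) set \<Rightarrow> (('n \<Rightarrow>\<^sub>0 nat) \<Rightarrow>\<^sub>0 'k::comm_ring_1) set" where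
  "mono_ideal U = {f. keys f \<subseteq> U}"

definition up_closed :: "('n \<Rightarrow>\<^sub>0 nat) set \<Rightarrow> bool" where
  "up_closed U \<longleftrightarrow> (\<forall>a\<in>U. \<forall>b. a + b \<in> U)"

lemma mem_mono_ideal: "f \<in> mono_ideal U \<longleftrightarrow> (\<forall>a. a \<notin> U \<longrightarrow> lookup f a = 0)"
  by (auto simp: mono_ideal_def in_keys_iff)

lemma single_mem_mono_ideal [simp]: "Poly_Mapping.single a c \<in> mono_ideal U \<longleftrightarrow> c = 0 \<or> a \<in> U"
  by (auto simp: mono_ideal_def)

lemma up_closedD: "up_closed U \<Longrightarrow> b \<in> U \<Longrightarrow> a + b \<in> U"
  by (auto simp: up_closed_def add.commute)

lemma is_ideal_mono_ideal:
  assumes "up_closed U"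
  shows "is_ideal (mono_ideal U)"
  unfolding is_ideal_def
proof (intro conjI ballI allI)
  fix r a :: "('a \<Rightarrow>\<^sub>0 nat) \<Rightarrow>\<^sub>0 'b" assume "a \<in> mono_ideal U"
  then have "b + c \<in> U" if "c \<in> keys a" for b c
    using that up_closedD[OF assms] by (auto simp: mono_ideal_def)
  then show "r * a \<in> mono_ideal U"
    using keys_mult[of r a] by (auto simp: mono_ideal_def)
qed (auto simp: mem_mono_ideal lookup_add)

lemma ideal_gen_monomials:
  fixes M :: "('n \<Rightarrow>\<^sub>0 nat) set"
  shows "ideal_gen ((\<lambda>m. Poly_Mapping.single m (1::'k::comm_ring_1)) ` M) = mono_ideal {m + b | m b. m \<in> M}"
    (is "ideal_gen ?G = mono_ideal ?U")
proof
  have "up_closed ?U" unfolding up_closed_def by (auto simp: add.assoc) metis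
  moreover have "m \<in> ?U" if "m \<in> M" for m using that add.right_neutral[of m] by force
  then have "?G \<subseteq> mono_ideal ?U" by (simp add: image_subset_iff)
  ultimately show "ideal_gen ?G \<subseteq> mono_ideal ?U"
    by (intro ideal_gen_minimal is_ideal_mono_ideal)
next
  note I = is_ideal_ideal_gen[of ?G]
  show "mono_ideal ?U \<subseteq> ideal_gen ?G"
  proof
    fix f :: "('n \<Rightarrow>\<^sub>0 nat) \<Rightarrow>\<^sub>0 'k" assume f: "f \<in> mono_ideal ?U"
    have "(\<Sum>a\<in>keys f. Poly_Mapping.single a (lookup f a)) \<in> ideal_gen ?G"
    proof (intro is_ideal_sum[OF I])
      fix a assume "a \<in> keys f"
      then obtain m b where m: "m \<in> M" "a = m + b" using f by (auto simp: mono_ideal_def)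
      have "Poly_Mapping.single m 1 \<in> ideal_gen ?G" using m ideal_gen_superset[of ?G] by auto
      from is_idealD(3)[OF I this, of "Poly_Mapping.single b (lookup f a)"]
      show "Poly_Mapping.single a (lookup f a) \<in> ideal_gen ?G"
        by (simp add: mult_single m add.commute)
    qed
    then show "f \<in> ideal_gen ?G" using poly_mapping_sum_single[of f] by simp
  qed
qed

definition edge_monos :: "(5 \<times> 5) set \<Rightarrow> (5 \<Rightarrow> nat) \<Rightarrow> (5 \<Rightarrow>\<^sub>0 nat) set" where
  "edge_monos E w = {a. \<exists>(i, j)\<in>E. 1 \<le> lookup a i \<and> w j \<le> lookup a j}"

lemma up_closed_edge_monos: "up_closed (edge_monos E w)"
  unfolding up_closed_def edge_monos_def by (force simp: lookup_add)

lemma var_power: "(var i ^ n :: 'k::field pol5) = Poly_Mapping.single (Poly_Mapping.single i n) 1"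
  by (induction n) (auto simp: var_def mult_single simp flip: single_add)

text \<open>In the absence of loops the two factors of a generator involve different variables, so
  divisibility by it splits into the two inequalities of \<open>edge_monos\<close>.\<close>

lemma edge_ideal_eq_mono_ideal:
  assumes "\<And>i. (i, i) \<notin> E"
  shows "(edge_ideal E w :: 'k::field pol5 set) = mono_ideal (edge_monos E w)"
proof -
  let ?M = "{pow i + Poly_Mapping.single j (w j) | i j. (i, j) \<in> E}"
  have "{var i * var j ^ w j | i j. (i, j) \<in> E} = (\<lambda>m. Poly_Mapping.single m (1::'k)) ` ?M"
    unfolding var_power by (auto simp: var_def mult_single)
  moreover have "{m + b | m b. m \<in> ?M} = edge_monos E w"
  proof (intro set_eqI iffI)
    fix a assume "a \<in> {m + b | m b. m \<in> ?M}"
    then obtain i j b where "(i, j) \<in> E" "a = pow i + Poly_Mapping.single j (w j) + b" by blast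
    then show "a \<in> edge_monos E w"
      by (auto simp: edge_monos_def lookup_add intro!: bexI[of _ "(i, j)"])
  next
    fix a assume "a \<in> edge_monos E w"
    then obtain i j where ij: "(i, j) \<in> E" "1 \<le> lookup a i" "w j \<le> lookup a j"
      by (auto simp: edge_monos_def)
    then have "i \<noteq> j" using assms by auto
    let ?m = "pow i + Poly_Mapping.single j (w j)"
    have "a = ?m + (a - ?m)"
      by (rule poly_mapping_eqI)
        (use ij \<open>i \<noteq> j\<close> in \<open>auto simp: lookup_add lookup_minus lookup_single when_def\<close>)
    then show "a \<in> {m + b | m b. m \<in> ?M}" using ij(1) by blast
  qed
  ultimately show ?thesis by (simp add: edge_ideal_def ideal_gen_monomials)
qed

lemma max_ideal_eq_mono_ideal: "(max_ideal :: 'k::field pol5 set) = mono_ideal {a. a \<noteq> 0}"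
proof -
  have "range var = (\<lambda>m. Poly_Mapping.single m (1::'k)) ` range pow"
    by (auto simp: var_def)
  moreover have "{m + b | m b. m \<in> range pow} = {a::5 \<Rightarrow>\<^sub>0 nat. a \<noteq> 0}"
  proof (intro set_eqI iffI)
    fix a :: "5 \<Rightarrow>\<^sub>0 nat" assume "a \<in> {m + b | m b. m \<in> range pow}"
    then obtain i b where "a = pow i + b" by blast
    then have "lookup a i \<noteq> 0" by (simp add: lookup_add)
    then show "a \<in> {a. a \<noteq> 0}" by auto
  next
    fix a :: "5 \<Rightarrow>\<^sub>0 nat" assume "a \<in> {a. a \<noteq> 0}"
    then obtain i where "lookup a i \<noteq> 0" by (auto simp: poly_mapping_eq_iff fun_eq_iff)
    then obtain b where "a = pow i + b" using pow_add_exists by metis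
    then show "a \<in> {m + b | m b. m \<in> range pow}" by blast
  qed
  ultimately show ?thesis by (simp add: max_ideal_def ideal_gen_monomials)
qed

section \<open>Depth at least two\<close>

definition h0_vanishes :: "('n \<Rightarrow> 'a::comm_ring_1) \<Rightarrow> 'a set \<Rightarrow> bool" where
  "h0_vanishes x I \<longleftrightarrow> (\<forall>g. (\<forall>i. x i * g \<in> I) \<longrightarrow> g \<in> I)"

definition h1_vanishes :: "('n \<Rightarrow> 'a::comm_ring_1) \<Rightarrow> 'a set \<Rightarrow> bool" where
  \<comment> \<open>Modulo \<open>I\<close>, these families \<open>u\<close> are the 1-cocycles of
    the Koszul complex on \<open>x\<close>, and the families \<open>x i * g\<close> are its
    1-coboundaries.\<close>
  "h1_vanishes x I \<longleftrightarrow>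
    (\<forall>u. (\<forall>i j. x i * u j - x j * u i \<in> I) \<longrightarrow> (\<exists>g. \<forall>i. u i - x i * g \<in> I))"

text \<open>Write \<open>f1\<close> and \<open>f2\<close> as combinations of the \<open>x i\<close>
  with coefficients \<open>a\<close>, \<open>b\<close>, and contract a cocycle \<open>u\<close> with
  them to get \<open>v\<close> and \<open>v'\<close>. The cocycle condition gives x_j v = f1 u_j,
  hence f2 v = f1 v' modulo \<open>I\<close>. Regularity of \<open>f2\<close> modulo
  \<open>f1\<close> yields v = r f1, and cancelling \<open>f1\<close> leaves u_j = x_j r.\<close>

lemma regular_seq_imp_vanishing:
  fixes x :: "'n::finite \<Rightarrow> 'a::comm_ring_1"
  assumes I: "is_ideal I" and reg: "regular_seq_quot (ideal_gen (range x)) I fs" and len: "2 \<le> length fs"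
  shows "h0_vanishes x I" "h1_vanishes x I"
proof -
  define f1 f2 where "f1 = fs ! 0" and "f2 = fs ! 1"
  have R: "fs ! i * g \<in> ideal_gen (I \<union> set (take i fs)) \<Longrightarrow> g \<in> ideal_gen (I \<union> set (take i fs))"
    if "i < length fs" for i g
    using reg that unfolding regular_seq_quot_def by blast
  have R1: "f1 * g \<in> I \<Longrightarrow> g \<in> I" for g
    using R[of 0 g] len ideal_gen_eq[OF I] by (cases fs) (auto simp: f1_def)
  have "set (take 1 fs) = {f1}" using len by (cases fs) (auto simp: f1_def)
  then have R2: "f2 * g \<in> ideal_gen (insert f1 I) \<Longrightarrow> g \<in> ideal_gen (insert f1 I)" for g
    using R[of 1 g] len by (simp add: f2_def)
  have "f1 \<in> set fs" "f2 \<in> set fs" unfolding f1_def f2_def using len by (auto intro!: nth_mem)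
  then obtain a b where f1: "f1 = (\<Sum>i\<in>UNIV. a i * x i)" and f2: "f2 = (\<Sum>i\<in>UNIV. b i * x i)"
    using reg unfolding regular_seq_quot_def
    by (metis mem_ideal_gen_range[THEN iffD1] subsetD)
  note I' = is_idealD[OF I]
  show "h0_vanishes x I"
    unfolding h0_vanishes_def
  proof (intro allI impI)
    fix g assume "\<forall>i. x i * g \<in> I"
    then have "(\<Sum>i\<in>UNIV. a i * (x i * g)) \<in> I" using I' by (intro is_ideal_sum[OF I]) auto
    then have "f1 * g \<in> I" by (simp add: f1 sum_distrib_right mult.assoc)
    then show "g \<in> I" by (rule R1)
  qed
  show "h1_vanishes x I"
    unfolding h1_vanishes_def
  proof (intro allI impI)
    fix u assume u: "\<forall>i j. x i * u j - x j * u i \<in> I"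
    define v v' where "v = (\<Sum>i\<in>UNIV. a i * u i)" and "v' = (\<Sum>i\<in>UNIV. b i * u i)"
    have 1: "x j * v - f1 * u j \<in> I" for j
    proof -
      have "(\<Sum>i\<in>UNIV. a i * (x j * u i - x i * u j)) \<in> I"
        using u I'(3) by (intro is_ideal_sum[OF I]) auto
      also have "(\<Sum>i\<in>UNIV. a i * (x j * u i - x i * u j)) = x j * v - f1 * u j"
        by (simp add: v_def f1 sum_distrib_left sum_distrib_right sum_subtractf algebra_simps)
      finally show ?thesis .
    qed
    have "(\<Sum>j\<in>UNIV. b j * (x j * v - f1 * u j)) \<in> I"
      using 1 I'(3) by (intro is_ideal_sum[OF I]) auto
    also have "(\<Sum>j\<in>UNIV. b j * (x j * v - f1 * u j)) = f2 * v - v' * f1"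
      by (simp add: v'_def f2 sum_distrib_left sum_distrib_right sum_subtractf algebra_simps)
    finally have "f2 * v \<in> ideal_gen (insert f1 I)"
      using ideal_gen_superset[of I] unfolding mem_ideal_gen_insert by blast
    from R2[OF this] obtain r where r: "v - r * f1 \<in> I"
      unfolding mem_ideal_gen_insert ideal_gen_eq[OF I] by blast
    have "u j - x j * r \<in> I" for j
    proof (rule R1)
      have "f1 * (u j - x j * r) = x j * (v - r * f1) - (x j * v - f1 * u j)"
        by (simp add: algebra_simps)
      also have "\<dots> \<in> I" by (rule I'(6)[OF I'(3)[OF r] 1])
      finally show "f1 * (u j - x j * r) \<in> I" .
    qed
    then show "\<exists>g. \<forall>i. u i - x i * g \<in> I" by blast
  qed
qed

text \<open>This is the piece of the long exact Koszul sequence of multiplication by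
  \<open>f\<close> that places H^0 modulo \<open>f\<close> between H^0 and H^1 modulo
  \<open>I\<close>. The family \<open>u\<close> below is the image of \<open>r\<close> under the
  connecting map.\<close>

lemma vanishing_imp_saturated:
  assumes I: "is_ideal I" and h0: "h0_vanishes x I" and h1: "h1_vanishes x I"
    and reg: "\<And>g. f * g \<in> I \<Longrightarrow> g \<in> I"
  shows "h0_vanishes x (ideal_gen (insert f I))"
  unfolding h0_vanishes_def
proof (intro allI impI)
  note I' = is_idealD[OF I]
  fix r assume "\<forall>i. x i * r \<in> ideal_gen (insert f I)"
  then obtain u where u: "\<And>i. x i * r - u i * f \<in> I"
    unfolding mem_ideal_gen_insert ideal_gen_eq[OF I] by metis
  have "x i * u j - x j * u i \<in> I" for i j
  proof (rule reg)
    have "f * (x i * u j - x j * u i) = x j * (x i * r - u i * f) - x i * (x j * r - u j * f)"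
      by (simp add: algebra_simps)
    also have "\<dots> \<in> I" by (rule I'(6)[OF I'(3)[OF u] I'(3)[OF u]])
    finally show "f * (x i * u j - x j * u i) \<in> I" .
  qed
  then obtain g where g: "\<And>i. u i - x i * g \<in> I" using h1 unfolding h1_vanishes_def by blast
  have "x i * (r - g * f) \<in> I" for i
  proof -
    have "x i * (r - g * f) = (x i * r - u i * f) + f * (u i - x i * g)" by (simp add: algebra_simps)
    also have "\<dots> \<in> I" by (rule I'(2)[OF u I'(3)[OF g]])
    finally show ?thesis .
  qed
  then have "r - g * f \<in> I" using h0 unfolding h0_vanishes_def by blast
  then show "r \<in> ideal_gen (insert f I)" unfolding mem_ideal_gen_insert ideal_gen_eq[OF I] by blast
qed

text \<open>Descending induction on exponents: a product of powers is in \<open>I\<close> once some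
  exponent reaches \<open>N i\<close>; otherwise all its multiples by a single \<open>x j\<close>
  are in \<open>I\<close> by induction, and \<open>h0_vanishes\<close> pulls the product itself into
  \<open>I\<close>. The exponent 0 gives 1.\<close>

lemma saturated_imp_one_mem:
  fixes x :: "'n::finite \<Rightarrow> 'a::comm_ring_1"
  assumes I: "is_ideal I" and h0: "h0_vanishes x I" and N: "\<And>i. x i ^ N i \<in> I"
  shows "1 \<in> I"
proof -
  have "(\<Prod>i\<in>UNIV. x i ^ n i) \<in> I" for n :: "'n \<Rightarrow> nat"
  proof (induction "\<Sum>i\<in>UNIV. N i - n i" arbitrary: n rule: less_induct)
    case less
    show ?case
    proof (cases "\<exists>i. N i \<le> n i")
      case True
      then obtain i where i: "N i \<le> n i" by blast
      then have "x i ^ n i = x i ^ (n i - N i) * x i ^ N i" by (simp flip: power_add)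
      then have "x i ^ n i \<in> I" using is_idealD(3)[OF I] N by metis
      then show ?thesis using is_idealD(4)[OF I] by (simp add: prod.remove[of _ i])
    next
      case False
      have "x j * (\<Prod>i\<in>UNIV. x i ^ n i) \<in> I" for j
      proof -
        let ?m = "n(j := Suc (n j))"
        have "x j * (\<Prod>i\<in>UNIV. x i ^ n i) = (\<Prod>i\<in>UNIV. x i ^ ?m i)"
          by (simp add: prod.remove[of _ j] mult.assoc)
        moreover have "(\<Sum>i\<in>UNIV. N i - ?m i) < (\<Sum>i\<in>UNIV. N i - n i)"
          using False by (intro sum_strict_mono_ex1) (auto simp: not_le intro!: bexI[of _ j] diff_less_mono2)
        ultimately show ?thesis using less by metis
      qed
      then show ?thesis using h0 unfolding h0_vanishes_def by blast
    qed
  qed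
  from this[of "\<lambda>_. 0"] show ?thesis by simp
qed

text \<open>If \<open>\<Sum> x\<^sub>i\<close> annihilates \<open>g\<close>, then \<open>x\<^sub>i\<close> annihilates the terms of \<open>g\<close> of largest degree in \<open>x\<^sub>i\<close>; hence \<open>x\<^sub>i g\<close>
  has fewer nonzero terms than \<open>g\<close> and is zero by induction.\<close>

lemma sum_var_regular:
  fixes g :: "'k::field pol5"
  assumes U: "up_closed U" and h0: "h0_vanishes var (mono_ideal U :: 'k pol5 set)"
    and g: "(\<Sum>i\<in>UNIV. var i) * g \<in> mono_ideal U"
  shows "g \<in> mono_ideal U"
  using g
proof (induction "card (keys g - U)" arbitrary: g rule: less_induct)
  case less
  note I = is_ideal_mono_ideal[OF U]
  show ?case
  proof (cases "keys g - U = {}")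
    case True
    then show ?thesis by (auto simp: mono_ideal_def)
  next
    case False
    have "var i * g \<in> mono_ideal U" for i
    proof (rule less.hyps)
      show "(\<Sum>i\<in>UNIV. var i) * (var i * g) \<in> mono_ideal U"
        using is_idealD(3)[OF I less.prems, of "var i"] by (simp add: mult.left_commute)
      have "Max ((\<lambda>a. lookup a i) ` (keys g - U)) \<in> (\<lambda>a. lookup a i) ` (keys g - U)"
        using False by (intro Max_in) auto
      then obtain m where m: "m \<in> keys g - U"
        and "lookup m i = Max ((\<lambda>a. lookup a i) ` (keys g - U))" by force
      then have max: "lookup a i \<le> lookup m i" if "a \<in> keys g - U" for a using that by simp
      have "pow i + m \<in> U"
      proof (rule ccontr)
        assume n: "pow i + m \<notin> U"
        \<comment> \<open>A term of \<open>g\<close> that reaches this monomial through another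
          variable has degree in x_i one above that of \<open>m\<close>, which is the largest
          outside \<open>U\<close>.\<close>
        have "lookup (var j * g) (pow i + m) = 0" if "j \<noteq> i" for j
        proof (cases "lookup (pow i + m) j = 0")
          case False
          then obtain c where c: "pow i + m = pow j + c" using pow_add_exists by metis
          then have "lookup (pow i + m) i = lookup (pow j + c) i" by simp
          then have "lookup c i = Suc (lookup m i)" using that by (simp add: lookup_add lookup_single)
          moreover have "c \<notin> U" using n up_closedD[OF U, of c "pow j"] c by auto
          ultimately have "c \<notin> keys g" using max[of c] by auto
          then show ?thesis unfolding c by (simp add: in_keys_iff)
        qed (simp add: lookup_var_mult_0)
        then have "(\<Sum>j\<in>UNIV - {i}. lookup (var j * g) (pow i + m)) = 0" by simp
        then have "lookup ((\<Sum>i\<in>UNIV. var i) * g) (pow i + m) = lookup g m"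
          unfolding sum_distrib_right lookup_sum by (subst sum.remove[of _ i]) simp_all
        then show False using less.prems n m False by (auto simp: mem_mono_ideal in_keys_iff)
      qed
      \<comment> \<open>Every term of the product outside \<open>U\<close> is the shift of a term of
        \<open>g\<close> outside \<open>U\<close>, and the shift of \<open>m\<close> has just been
        lost to \<open>U\<close>; so the count drops.\<close>
      then have "keys (var i * g) - U \<subseteq> (+) (pow i) ` (keys g - U - {m})"
      proof (intro subsetI)
        fix b assume b: "b \<in> keys (var i * g) - U"
        then have "lookup b i \<noteq> 0" using lookup_var_mult_0[of b i g] by (auto simp: in_keys_iff)
        then obtain a where a: "b = pow i + a" using pow_add_exists by metis
        with b have "a \<in> keys g" "a \<notin> U" using up_closedD[OF U] by (auto simp: in_keys_iff)
        with b a \<open>pow i + m \<in> U\<close> show "b \<in> (+) (pow i) ` (keys g - U - {m})" by auto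
      qed
      then have "card (keys (var i * g) - U) \<le> card (keys g - U - {m})"
        by (meson surj_card_le finite_Diff finite_keys)
      also have "\<dots> < card (keys g - U)" using m False by (intro card_Diff1_less) auto
      finally show "card (keys (var i * g) - U) < card (keys g - U)" .
    qed
    then show ?thesis using h0 unfolding h0_vanishes_def by blast
  qed
qed

section \<open>The five-cycle and the explicit regular sequence\<close>

lemma UNIV_5: "(UNIV :: 5 set) = {0, 1, 2, 3, 4}"
proof -
  have "x \<in> {0, 1, 2, 3, 4}" for x :: 5
  proof (cases x)
    case (of_int z)
    then have "z \<in> {0, 1, 2, 3, 4}" by auto
    then show ?thesis using of_int by auto
  qed
  then show ?thesis by blast
qed

lemma wrap_5: "(5 :: 5) = 0" "(6 :: 5) = 1" "(7 :: 5) = 2" "(8 :: 5) = 3"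
  by simp_all

lemma UNIV_5_shift: "(UNIV :: 5 set) = {i, i + 1, i + 2, i + 3, i + 4}"
proof -
  have "x - i \<in> {0, 1, 2, 3, 4}" for x :: 5 using UNIV_5 by blast
  then have "x \<in> {i, i + 1, i + 2, i + 3, i + 4}" for x by (auto simp: algebra_simps)
  then show ?thesis by blast
qed

lemma sum_UNIV_5_shift: "sum h (UNIV :: 5 set) = h i + h (i + 1) + h (i + 2) + h (i + 3) + h (i + 4)"
  unfolding UNIV_5_shift[of i] by (simp add: add.assoc)

text \<open>Work in the radical \<open>R\<close> of \<open>K\<close>, which contains the products
  over edges. Two distinct diagonals cover at least three vertices, hence an edge, so multiplying
  the second sum by one diagonal product leaves only its square modulo \<open>R\<close>. With edge
  and diagonal products in \<open>R\<close>, multiplying the first sum by \<open>y i\<close> leaves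
  only the square of \<open>y i\<close>.\<close>

lemma pentagon_system_of_parameters:
  fixes y :: "5 \<Rightarrow> 'a::comm_ring_1"
  assumes K: "is_ideal K" and f1: "(\<Sum>i\<in>UNIV. y i) \<in> K" and f2: "(\<Sum>i\<in>UNIV. y i * y (i + 2)) \<in> K"
    and e: "\<And>i. \<exists>n. (y i * y (i + 1)) ^ n \<in> K"
  shows "\<exists>n. y i ^ n \<in> K"
proof -
  define R where "R = {a. \<exists>n. a ^ n \<in> K}"
  have R: "is_ideal R"
    unfolding is_ideal_def
  proof (intro conjI ballI allI)
    show "0 \<in> R" using is_idealD(1)[OF K] by (auto simp: R_def intro: exI[of _ 1])
    show "a + b \<in> R" if "a \<in> R" "b \<in> R" for a b
      using that radical_add[OF K] unfolding R_def by blast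
    show "r * a \<in> R" if "a \<in> R" for r a
      using that is_idealD(3)[OF K] unfolding R_def by (auto simp: power_mult_distrib)
  qed
  have sq: "a \<in> R" if "a * a \<in> R" for a
    using that unfolding R_def by (auto simp flip: power2_eq_square power_mult)
  have KR: "K \<subseteq> R" by (auto simp: R_def intro: exI[of _ 1])
  have e: "y i * y (i + 1) \<in> R" for i using e by (auto simp: R_def)
  note R' = is_idealD[OF R]
  have d: "y i * y (i + 2) \<in> R" for i
  proof (rule sq)
    define s where "s = (\<Sum>i\<in>UNIV. y i * y (i + 2))"
    have s: "s = y i * y (i + 2) + y (i + 1) * y (i + 3) + y (i + 2) * y (i + 4) + y (i + 3) * y i
        + y (i + 4) * y (i + 1)"
      unfolding s_def sum_UNIV_5_shift[of _ i] by (simp add: add.assoc wrap_5)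
    have "y i * y (i + 2) * (y i * y (i + 2)) = y i * y (i + 2) * s
      - y i * y (i + 3) * (y (i + 1) * y (i + 2))
      - y (i + 2) * y (i + 2) * (y (i + 4) * y i)
      - y i * y i * (y (i + 2) * y (i + 3))
      - y (i + 2) * y (i + 4) * (y i * y (i + 1))"
      unfolding s by (simp add: algebra_simps)
    also have "\<dots> \<in> R"
    proof -
      have "s \<in> R" using f2 KR by (auto simp: s_def)
      moreover have "y (i + 1) * y (i + 2) \<in> R" using e[of "i + 1"] by (simp add: add.assoc)
      moreover have "y (i + 4) * y i \<in> R" using e[of "i + 4"] by (simp add: add.assoc wrap_5)
      moreover have "y (i + 2) * y (i + 3) \<in> R" using e[of "i + 2"] by (simp add: add.assoc)
      ultimately show ?thesis using e[of i] by (meson R'(3,6))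
    qed
    finally show "y i * y (i + 2) * (y i * y (i + 2)) \<in> R" .
  qed
  have "y i \<in> R"
  proof (rule sq)
    define s where "s = (\<Sum>i\<in>UNIV. y i)"
    have s: "s = y i + y (i + 1) + y (i + 2) + y (i + 3) + y (i + 4)"
      unfolding s_def sum_UNIV_5_shift[of _ i] ..
    have "y i * y i = y i * s - y i * y (i + 1) - y i * y (i + 2) - y (i + 3) * y i - y (i + 4) * y i"
      unfolding s by (simp add: algebra_simps)
    also have "\<dots> \<in> R"
    proof -
      have "s \<in> R" using f1 KR by (auto simp: s_def)
      moreover have "y (i + 3) * y i \<in> R" using d[of "i + 3"] by (simp add: add.assoc wrap_5)
      moreover have "y (i + 4) * y i \<in> R" using e[of "i + 4"] by (simp add: add.assoc wrap_5)
      ultimately show ?thesis using e[of i] d[of i] by (meson R'(3,6))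
    qed
    finally show "y i * y i \<in> R" .
  qed
  then show ?thesis by (simp add: R_def)
qed

lemma regular_seq_two:
  fixes \<sigma> :: "5 \<Rightarrow> 5"
  assumes U: "up_closed U" "0 \<notin> U" and \<sigma>: "bij \<sigma>"
    and e: "\<And>i. \<exists>n. (var (\<sigma> i) * var (\<sigma> (i + 1))) ^ n \<in> (mono_ideal U :: 'k::field pol5 set)"
    and h0: "h0_vanishes var (mono_ideal U :: 'k::field pol5 set)"
    and h1: "h1_vanishes var (mono_ideal U :: 'k::field pol5 set)"
  shows "regular_seq_quot max_ideal (mono_ideal U :: 'k::field pol5 set)
      [(\<Sum>i\<in>UNIV. var i), (\<Sum>i\<in>UNIV. var (\<sigma> i) * var (\<sigma> (i + 2)))]"
proof -
  let ?I = "mono_ideal U :: 'k pol5 set"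
  define f1 f2 :: "'k pol5" where "f1 = (\<Sum>i\<in>UNIV. var i)" and
    "f2 = (\<Sum>i\<in>UNIV. var (\<sigma> i) * var (\<sigma> (i + 2)))"
  note I = is_ideal_mono_ideal[OF U(1)]
  have M: "is_ideal (max_ideal :: 'k pol5 set)" unfolding max_ideal_def by (rule is_ideal_ideal_gen)
  have vM: "var i \<in> (max_ideal :: 'k pol5 set)" for i
    unfolding max_ideal_def using ideal_gen_superset by blast
  have fM: "f1 \<in> max_ideal" "f2 \<in> max_ideal"
    unfolding f1_def f2_def by (auto intro!: is_ideal_sum[OF M] is_idealD[OF M] vM)
  have "1 \<notin> (max_ideal :: 'k pol5 set)"
    unfolding max_ideal_eq_mono_ideal by (simp flip: single_one)
  moreover have "?I \<subseteq> max_ideal" using U(2) unfolding max_ideal_eq_mono_ideal by (auto simp: mono_ideal_def)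
  ultimately have proper: "ideal_gen (?I \<union> {f1, f2}) \<noteq> UNIV"
    using ideal_gen_minimal[OF M, of "?I \<union> {f1, f2}"] fM by auto
  have reg1: "g \<in> ?I" if "f1 * g \<in> ?I" for g
    using sum_var_regular[OF U(1) h0] that unfolding f1_def by blast
  define J where "J = ideal_gen (insert f1 ?I)"
  have J: "is_ideal J" unfolding J_def by (rule is_ideal_ideal_gen)
  have IJ: "?I \<subseteq> J" "f1 \<in> J" using ideal_gen_superset[of "insert f1 ?I"] by (auto simp: J_def)
  have J0: "h0_vanishes var J"
    unfolding J_def by (rule vanishing_imp_saturated[OF I h0 h1 reg1])
  have reg2: "g \<in> J" if g: "f2 * g \<in> J" for g
  proof -
    \<comment> \<open>The colon ideal of \<open>g\<close> over \<open>J\<close> inherits saturation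
      from \<open>J\<close> and contains both parameters, hence a power of each variable. A
      saturated ideal of this kind contains 1, which means that \<open>g\<close> is in
      \<open>J\<close>.\<close>
    define K where "K = {r. r * g \<in> J}"
    have K: "is_ideal K"
      unfolding is_ideal_def K_def using is_idealD[OF J] by (auto simp: distrib_right mult.assoc)
    have "h0_vanishes var K"
      using J0 unfolding h0_vanishes_def K_def by (auto simp: mult.assoc)
    moreover have "\<exists>n. var (\<sigma> i) ^ n \<in> K" for i
    proof (rule pentagon_system_of_parameters[OF K, where y = "\<lambda>i. var (\<sigma> i)"])
      have "f1 * g \<in> J" using is_idealD(4)[OF J IJ(2)] .
      moreover have "f1 = (\<Sum>i\<in>UNIV. var (\<sigma> i))"
        unfolding f1_def by (rule sum.reindex_bij_betw[OF \<sigma>, of "var", symmetric])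
      ultimately show "(\<Sum>i\<in>UNIV. var (\<sigma> i)) \<in> K" by (simp add: K_def)
      show "(\<Sum>i\<in>UNIV. var (\<sigma> i) * var (\<sigma> (i + 2))) \<in> K" using g by (simp add: K_def f2_def)
      show "\<exists>n. (var (\<sigma> i) * var (\<sigma> (i + 1))) ^ n \<in> K" for i
        using e[of i] IJ(1) is_idealD(4)[OF J] by (auto simp: K_def)
    qed
    then have "\<forall>i. \<exists>n. var i ^ n \<in> K" using \<sigma> by (metis bij_pointE)
    then obtain N where "\<And>i. var i ^ N i \<in> K" by metis
    ultimately have "1 \<in> K" using saturated_imp_one_mem[OF K] by blast
    then show ?thesis by (simp add: K_def)
  qed
  have "regular_seq_quot max_ideal ?I [f1, f2]"
    unfolding regular_seq_quot_def
  proof (intro conjI allI impI)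
    fix i g assume "i < length [f1, f2]" and
      a: "[f1, f2] ! i * g \<in> ideal_gen (?I \<union> set (take i [f1, f2]))"
    then consider "i = 0" | "i = 1" by fastforce
    then show "g \<in> ideal_gen (?I \<union> set (take i [f1, f2]))"
      using a reg1 reg2 by cases (auto simp: ideal_gen_eq[OF I] J_def)
  qed (use fM proper in auto)
  then show ?thesis unfolding f1_def f2_def .
qed

section \<open>The vanishing condition for monomial ideals\<close>

text \<open>The first clause is the vanishing of \<open>H\<^sup>0\<close> in multidegree \<open>a\<close>. A cocycle of \<open>H\<^sup>1\<close> has components
  \<open>c\<^sub>i x\<^sup>a x\<^sub>i\<close>: the second clause treats a multidegree with an entry \<open>-1\<close> at \<open>i\<close>, and the third,
  connectedness of a graph on the \<open>i\<close> with \<open>x\<^sup>a x\<^sub>i\<close> nonzero, forces all \<open>c\<^sub>i\<close> to agree.\<close>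

definition mono_vanishing :: "('n \<Rightarrow>\<^sub>0 nat) set \<Rightarrow> bool" where
  "mono_vanishing U \<longleftrightarrow> (\<forall>a. a \<notin> U \<longrightarrow>
     (\<exists>i. pow i + a \<notin> U) \<and>
     (\<forall>i. lookup a i = 0 \<longrightarrow> (\<exists>j. j \<noteq> i \<and> pow j + a \<notin> U)) \<and>
     (\<forall>X. (\<exists>i\<in>X. pow i + a \<notin> U) \<and> (\<exists>j\<in>-X. pow j + a \<notin> U) \<longrightarrow>
          (\<exists>i\<in>X. \<exists>j\<in>-X. pow i + (pow j + a) \<notin> U)))"

lemma h0_vanishes_mono_ideal:
  assumes U: "up_closed U" and C: "\<And>a. a \<notin> U \<Longrightarrow> \<exists>i. pow i + a \<notin> U"
  shows "h0_vanishes var (mono_ideal U :: 'k::field pol5 set)"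
  unfolding h0_vanishes_def mem_mono_ideal
proof (intro allI impI)
  fix g :: "'k pol5" and a
  assume g: "\<forall>i b. b \<notin> U \<longrightarrow> lookup (var i * g) b = 0" and "a \<notin> U"
  then obtain i where "pow i + a \<notin> U" using C by blast
  with g have "lookup (var i * g) (pow i + a) = 0" by blast
  then show "lookup g a = 0" by simp
qed

text \<open>The coefficient of the desired \<open>g\<close> at a is read off from any component
  \<open>u i\<close> at x_i x^a. The connectedness clause of \<open>mono_vanishing\<close> makes the
  value independent of \<open>i\<close>.\<close>

lemma h1_vanishes_mono_ideal:
  assumes U: "up_closed U" and C: "mono_vanishing U"
  shows "h1_vanishes var (mono_ideal U :: 'k::field pol5 set)"
  unfolding h1_vanishes_def
proof (intro allI impI)
  fix u :: "5 \<Rightarrow> 'k pol5"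
  assume "\<forall>i j. var i * u j - var j * u i \<in> mono_ideal U"
  then have u: "lookup (var i * u j) b = lookup (var j * u i) b" if "b \<notin> U" for i j b
    using that by (simp add: mem_mono_ideal lookup_minus)
  have adj: "lookup (u i) (pow i + a) = lookup (u j) (pow j + a)" if "pow i + (pow j + a) \<notin> U" for i j a
    using u[OF that, of i j] lookup_var_mult_add[of j "u i" "pow i + a"] by (simp add: add.left_commute)
  have const: "lookup (u i) (pow i + a) = lookup (u j) (pow j + a)"
    if a: "a \<notin> U" "pow i + a \<notin> U" "pow j + a \<notin> U" for i j a
  proof (rule ccontr)
    assume ne: "lookup (u i) (pow i + a) \<noteq> lookup (u j) (pow j + a)"
    define X where "X = {k. lookup (u k) (pow k + a) = lookup (u i) (pow i + a)}"
    have "i \<in> X" "j \<in> - X" using ne by (auto simp: X_def)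
    then obtain k l where "k \<in> X" "l \<in> - X" "pow k + (pow l + a) \<notin> U"
      using C[unfolded mono_vanishing_def, rule_format, OF a(1)] a(2,3) by meson
    then show False using adj by (auto simp: X_def)
  qed
  \<comment> \<open>An arbitrary vertex at which to read off the coefficient; by
    \<open>const\<close> any choice gives the same value.\<close>
  define s where "s a = (SOME i. pow i + a \<notin> U)" for a
  have s: "pow (s a) + a \<notin> U" if "a \<notin> U" for a
    unfolding s_def by (rule someI_ex) (use C that in \<open>auto simp: mono_vanishing_def\<close>)
  define g0 where "g0 a = (if a \<in> U then 0 else lookup (u (s a)) (pow (s a) + a))" for a
  have "{a. g0 a \<noteq> 0} \<subseteq> (\<Union>i. (+) (pow i) -` keys (u i))"
    by (auto simp: g0_def in_keys_iff split: if_splits)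
  moreover have "finite (\<Union>i. (+) (pow i) -` keys (u i))"
    by (intro finite_UN_I finite_vimageI) (auto intro!: injI)
  ultimately have "finite {a. g0 a \<noteq> 0}" by (rule finite_subset)
  then have g: "lookup (Abs_poly_mapping g0) = g0" by simp
  have "u i - var i * Abs_poly_mapping g0 \<in> mono_ideal U" for i
    unfolding mem_mono_ideal lookup_minus
  proof (intro allI impI)
    fix b assume b: "b \<notin> U"
    show "lookup (u i) b - lookup (var i * Abs_poly_mapping g0) b = 0"
    proof (cases "lookup b i = 0")
      case True
      \<comment> \<open>Multidegree with entry -1 at \<open>i\<close>: no multiple of x_i has a term
        at \<open>b\<close>, so \<open>u i\<close> must vanish there. The cocycle condition with
        \<open>j\<close> moves its coefficient into a multiple of x_i at a monomial that x_i does
        not divide.\<close>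
      then obtain j where j: "j \<noteq> i" "pow j + b \<notin> U" using C b unfolding mono_vanishing_def by meson
      have "lookup (u i) b = lookup (var i * u j) (pow j + b)" using u[OF j(2), of i j] by simp
      also have "\<dots> = 0"
        using True j(1) by (intro lookup_var_mult_0) (simp add: lookup_add lookup_single)
      finally show ?thesis using True by (simp add: lookup_var_mult_0)
    next
      case False
      then obtain a where a: "b = pow i + a" using pow_add_exists by metis
      with b have "a \<notin> U" using up_closedD[OF U] by blast
      then show ?thesis using const[of a i "s a"] s[of a] b by (simp add: a g g0_def)
    qed
  qed
  then show "\<exists>g. \<forall>i. u i - var i * g \<in> mono_ideal U" by blast
qed

lemma vanishing_imp_mono_vanishing:
  assumes U: "up_closed U"
    and h0: "h0_vanishes var (mono_ideal U :: 'k::field pol5 set)"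
    and h1: "h1_vanishes var (mono_ideal U :: 'k::field pol5 set)"
  shows "mono_vanishing U"
  unfolding mono_vanishing_def
proof (intro allI impI conjI)
  fix a assume a: "a \<notin> U"
  have var_single: "var i * Poly_Mapping.single b 1 = (Poly_Mapping.single (pow i + b) 1 :: 'k pol5)" for i b
    by (simp add: var_def mult_single)
  have cocycle: False
    if "\<And>i j. var i * u j - var j * u i \<in> mono_ideal U"
      and "\<And>g. (\<And>i b. b \<notin> U \<Longrightarrow> lookup (u i) b = lookup (var i * g) b) \<Longrightarrow> False" for u :: "5 \<Rightarrow> 'k pol5"
    using h1 that unfolding h1_vanishes_def by (simp add: mem_mono_ideal lookup_minus) metis
  show "\<exists>i. pow i + a \<notin> U"
  proof (rule ccontr)
    assume "\<nexists>i. pow i + a \<notin> U"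
    then have "\<forall>i. var i * Poly_Mapping.single a 1 \<in> (mono_ideal U :: 'k pol5 set)"
      by (simp add: var_single)
    then have "Poly_Mapping.single a 1 \<in> (mono_ideal U :: 'k pol5 set)"
      using h0 unfolding h0_vanishes_def by blast
    then show False using a by simp
  qed
  show "\<exists>j. j \<noteq> i \<and> pow j + a \<notin> U" if i: "lookup a i = 0" for i
  proof (rule ccontr)
    assume n: "\<nexists>j. j \<noteq> i \<and> pow j + a \<notin> U"
    \<comment> \<open>A cocycle because all x_j x^a with j other than \<open>i\<close> lie in
      \<open>U\<close>; no coboundary, because x_i does not divide x^a.\<close>
    define u :: "5 \<Rightarrow> 'k pol5" where "u j = (if j = i then Poly_Mapping.single a 1 else 0)" for j
    show False
    proof (rule cocycle)
      show "var j * u k - var k * u j \<in> mono_ideal U" for j k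
        using n is_idealD(1)[OF is_ideal_mono_ideal[OF U]]
        by (auto simp: u_def var_single simp flip: single_uminus)
      show False if "\<And>j b. b \<notin> U \<Longrightarrow> lookup (u j) b = lookup (var j * g) b" for g
        using that[OF a, of i] i by (simp add: u_def lookup_var_mult_0)
    qed
  qed
  fix X assume X: "(\<exists>i\<in>X. pow i + a \<notin> U) \<and> (\<exists>j\<in>-X. pow j + a \<notin> U)"
  then obtain i j where ij: "i \<in> X" "pow i + a \<notin> U" "j \<notin> X" "pow j + a \<notin> U" by auto
  show "\<exists>i\<in>X. \<exists>j\<in>-X. pow i + (pow j + a) \<notin> U"
  proof (rule ccontr)
    assume n: "\<not> (\<exists>i\<in>X. \<exists>j\<in>-X. pow i + (pow j + a) \<notin> U)"
    \<comment> \<open>The coefficients c_k are the indicator function of \<open>X\<close>. No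
      surviving product links \<open>X\<close> to its complement, so this is a cocycle; a coboundary
      would need equal coefficients at \<open>i\<close> and \<open>j\<close>.\<close>
    define u :: "5 \<Rightarrow> 'k pol5" where "u k = (if k \<in> X then Poly_Mapping.single (pow k + a) 1 else 0)" for k
    show False
    proof (rule cocycle)
      show "var j * u k - var k * u j \<in> mono_ideal U" for j k
        using n is_idealD(1)[OF is_ideal_mono_ideal[OF U]]
        by (auto simp: u_def var_single add.left_commute simp flip: single_uminus)
      show False if g: "\<And>j b. b \<notin> U \<Longrightarrow> lookup (u j) b = lookup (var j * g) b" for g
        using g[OF ij(2), of i] g[OF ij(4), of j] ij by (simp add: u_def)
    qed
  qed
qed

lemma mono_vanishing_iff:
  assumes "up_closed U"
  shows "mono_vanishing U \<longleftrightarrow> h0_vanishes var (mono_ideal U :: 'k::field pol5 set) \<and>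
    h1_vanishes var (mono_ideal U :: 'k pol5 set)"
  using vanishing_imp_mono_vanishing[OF assms] h1_vanishes_mono_ideal[OF assms]
    h0_vanishes_mono_ideal[OF assms] unfolding mono_vanishing_def by blast

section \<open>Depth and dimension at most two\<close>

lemma is_ideal_add_cancel:
  assumes "is_ideal I" "b \<in> I"
  shows "a + b \<in> I \<longleftrightarrow> a \<in> I"
  using is_idealD(6)[OF assms(1) _ assms(2), of "a + b"] is_idealD(2)[OF assms(1) _ assms(2), of a] by auto

text \<open>Gaussian elimination, one equation at a time: multiples of equation \<open>s\<close>
  remove the unknown \<open>t0\<close> from the others, and \<open>e\<close> is the value at
  \<open>t0\<close> that \<open>s\<close> then dictates.\<close>

lemma homogeneous_system_nontrivial_solution:
  fixes c :: "'s \<Rightarrow> 't \<Rightarrow> 'k::field"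
  assumes "finite S" "finite T" "card S < card T"
  shows "\<exists>v. (\<exists>t\<in>T. v t \<noteq> 0) \<and> (\<forall>s\<in>S. (\<Sum>t\<in>T. c s t * v t) = 0)"
  using assms
proof (induction S arbitrary: T c rule: finite_induct)
  case empty
  then have "T \<noteq> {}" by auto
  then show ?case by (intro exI[of _ "\<lambda>_. 1"]) auto
next
  case (insert s S)
  show ?case
  proof (cases "\<forall>t\<in>T. c s t = 0")
    case True
    have "card S < card T" using insert by simp
    then obtain v where "\<exists>t\<in>T. v t \<noteq> 0" "\<forall>s\<in>S. (\<Sum>t\<in>T. c s t * v t) = 0"
      using insert.IH[OF insert.prems(1)] by blast
    then show ?thesis using True by (intro exI[of _ v]) auto
  next
    case False
    then obtain t0 where t0: "t0 \<in> T" "c s t0 \<noteq> 0" by blast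
    define d where "d r t = c r t - c r t0 * c s t / c s t0" for r t
    have "card S < card (T - {t0})" using insert t0 by (simp add: card_Diff_singleton)
    then obtain v where v: "\<exists>t\<in>T - {t0}. v t \<noteq> 0" "\<forall>r\<in>S. (\<Sum>t\<in>T - {t0}. d r t * v t) = 0"
      using insert.IH[of "T - {t0}" d] insert.prems(1) by blast
    define e where "e = - (\<Sum>t\<in>T - {t0}. c s t * v t) / c s t0"
    have split: "(\<Sum>t\<in>T. c r t * (v(t0 := e)) t) = c r t0 * e + (\<Sum>t\<in>T - {t0}. c r t * v t)" for r
      using sum.remove[OF insert.prems(1) t0(1), of "\<lambda>t. c r t * (v(t0 := e)) t"] by simp
    have "(\<Sum>t\<in>T. c r t * (v(t0 := e)) t) = (\<Sum>t\<in>T - {t0}. d r t * v t)" for r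
      unfolding split unfolding d_def e_def
      by (simp add: left_diff_distrib sum_subtractf sum_distrib_left sum_divide_distrib mult.assoc
          flip: sum_negf)
    moreover have "(\<Sum>t\<in>T - {t0}. d s t * v t) = 0" using t0 by (simp add: d_def)
    ultimately show ?thesis using v t0 by (intro exI[of _ "v(t0 := e)"]) auto
  qed
qed

text \<open>Applied below three times in a nested way, to powers of f3, f2 and f1, where the lowest
  coefficient \<open>g m\<close> is itself such a sum.\<close>

lemma sum_powers_lowest_term:
  fixes f :: "'a::comm_ring_1"
  assumes "m < n" "\<And>i. i < m \<Longrightarrow> g i = 0"
  shows "\<exists>a. (\<Sum>i<n. g i * f ^ i) = f ^ m * (g m + f * a)"
proof -
  have "{..<n} = {..<m} \<union> insert m {m<..<n}" using assms(1) by auto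
  then have "(\<Sum>i<n. g i * f ^ i) = (\<Sum>i\<in>{..<m} \<union> insert m {m<..<n}. g i * f ^ i)" by simp
  also have "\<dots> = (\<Sum>i<m. g i * f ^ i) + (g m * f ^ m + (\<Sum>i\<in>{m<..<n}. g i * f ^ i))"
    by (subst sum.union_disjoint) auto
  also have "(\<Sum>i<m. g i * f ^ i) = 0" using assms(2) by simp
  also have "(\<Sum>i\<in>{m<..<n}. g i * f ^ i) = (\<Sum>i\<in>{m<..<n}. f ^ m * (f * (g i * f ^ (i - Suc m))))"
  proof (intro sum.cong refl)
    fix i assume "i \<in> {m<..<n}"
    then have "f ^ i = f ^ (m + (1 + (i - Suc m)))" by simp
    then show "g i * f ^ i = f ^ m * (f * (g i * f ^ (i - Suc m)))"
      by (simp only: power_add power_one_right mult_ac)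
  qed
  finally show ?thesis
    by (auto intro!: exI[of _ "\<Sum>i\<in>{m<..<n}. g i * f ^ (i - Suc m)"]
        simp: distrib_left sum_distrib_left mult.commute)
qed

definition exps_le :: "nat \<Rightarrow> (('n \<Rightarrow>\<^sub>0 nat) \<Rightarrow>\<^sub>0 'k::comm_ring_1) \<Rightarrow> bool" where
  "exps_le D f \<longleftrightarrow> (\<forall>a\<in>keys f. \<forall>i. lookup a i \<le> D)"

lemma exps_le_mono: "exps_le D f \<Longrightarrow> D \<le> E \<Longrightarrow> exps_le E f"
  unfolding exps_le_def by (meson order_trans)

lemma exps_le_mult: "exps_le D f \<Longrightarrow> exps_le E g \<Longrightarrow> exps_le (D + E) (f * g)"
  using keys_mult[of f g] unfolding exps_le_def by (fastforce simp: lookup_add intro: add_mono)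

lemma exps_le_power: "exps_le D f \<Longrightarrow> exps_le (n * D) (f ^ n)"
proof (induction n)
  case 0
  then show ?case by (simp add: exps_le_def)
next
  case (Suc n)
  then show ?case using exps_le_mult[of D f "n * D" "f ^ n"] by simp
qed

lemma ex_exps_le:
  fixes f :: "('n::finite \<Rightarrow>\<^sub>0 nat) \<Rightarrow>\<^sub>0 'k::comm_ring_1"
  shows "\<exists>D. exps_le D f"
proof -
  have "finite ((\<lambda>(a, i). lookup a i) ` (keys f \<times> UNIV))" by simp
  then obtain D where "\<forall>x\<in>(\<lambda>(a, i). lookup a i) ` (keys f \<times> UNIV). x \<le> D"
    using finite_nat_set_iff_bounded_le by blast
  then show ?thesis by (auto simp: exps_le_def)
qed

text \<open>Counting the monomials outside \<open>U\<close> gives an algebraic relation between any three polynomials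
  modulo a monomial ideal of dimension at most two; the nested form displays its lowest term.\<close>

lemma algebraic_relation_mod_mono_ideal:
  fixes f1 f2 f3 :: "('n::finite \<Rightarrow>\<^sub>0 nat) \<Rightarrow>\<^sub>0 'k::field"
  assumes count: "\<And>B. finite {a. a \<notin> U \<and> (\<forall>i. lookup a i \<le> B)}"
    "\<And>B. card {a. a \<notin> U \<and> (\<forall>i. lookup a i \<le> B)} \<le> C * (B + 1)\<^sup>2"
  shows "\<exists>l m n r p q s. r \<noteq> 0 \<and>
    f1 ^ l * (f2 ^ m * (f3 ^ n * (Poly_Mapping.single 0 r + f3 * p) + f2 * q) + f1 * s) \<in> mono_ideal U"
proof -
  obtain D1 D2 D3 where "exps_le D1 f1" "exps_le D2 f2" "exps_le D3 f3" using ex_exps_le by metis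
  define D where "D = D1 + D2 + D3"
  have D: "exps_le D f1" "exps_le D f2" "exps_le D f3"
    unfolding D_def by (rule exps_le_mono, fact, simp)+
  \<comment> \<open>There are n^3 unknowns. The exponents of the products stay below 3nD, so the
    number of equations is at most C (3nD + 1)^2, hence at most n^2 C (3D + 1)^2; this
    \<open>n\<close> makes that smaller than n^3.\<close>
  define n where "n = C * (3 * D + 1)\<^sup>2 + 1"
  define T where "T = {..<n} \<times> {..<n} \<times> {..<n}"
  define S where "S = {a. a \<notin> U \<and> (\<forall>i. lookup a i \<le> 3 * n * D)}"
  define h where "h = (\<lambda>(i, j, k). f3 ^ k * f2 ^ j * f1 ^ i)"
  have "card S \<le> C * (3 * n * D + 1)\<^sup>2" unfolding S_def by (rule count(2))
  also have "\<dots> \<le> C * (n * (3 * D + 1))\<^sup>2"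
    by (intro mult_left_mono power_mono) (auto simp: n_def algebra_simps)
  also have "\<dots> = n\<^sup>2 * (C * (3 * D + 1)\<^sup>2)" by (simp only: power_mult_distrib mult_ac)
  also have "\<dots> < n\<^sup>2 * n" by (simp add: n_def)
  also have "n\<^sup>2 * n = card T" by (simp add: T_def power2_eq_square)
  finally obtain v where v: "\<exists>t\<in>T. v t \<noteq> 0" "\<forall>a\<in>S. (\<Sum>t\<in>T. lookup (h t) a * v t) = 0"
    using homogeneous_system_nontrivial_solution[of S T "\<lambda>a t. lookup (h t) a"] count(1)
    unfolding S_def T_def by auto
  have h: "exps_le (3 * n * D) (h t)" if "t \<in> T" for t
  proof -
    obtain i j k where t: "t = (i, j, k)" "i < n" "j < n" "k < n"
      using \<open>t \<in> T\<close> by (cases t) (auto simp: T_def)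
    have "exps_le (k * D + j * D + i * D) (h t)"
      unfolding t h_def prod.case by (intro exps_le_mult exps_le_power D)
    moreover have "k * D + j * D + i * D \<le> n * D + n * D + n * D"
      using t by (intro add_mono mult_right_mono) auto
    moreover have "n * D + n * D + n * D = 3 * n * D" by simp
    ultimately show ?thesis using exps_le_mono by metis
  qed
  define c where "c = (\<lambda>t. Poly_Mapping.single 0 (v t) :: ('n \<Rightarrow>\<^sub>0 nat) \<Rightarrow>\<^sub>0 'k)"
  have "(\<Sum>t\<in>T. c t * h t) \<in> mono_ideal U"
    unfolding mem_mono_ideal
  proof (intro allI impI)
    fix a assume a: "a \<notin> U"
    have "lookup (Poly_Mapping.single 0 r * f) a = lookup f a * r" for r and f :: "('n \<Rightarrow>\<^sub>0 nat) \<Rightarrow>\<^sub>0 'k"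
      using lookup_single_mult_add[of 0 r f a] by (simp add: mult.commute[of r])
    then have *: "lookup (\<Sum>t\<in>T. c t * h t) a = (\<Sum>t\<in>T. lookup (h t) a * v t)"
      unfolding lookup_sum c_def by simp
    show "lookup (\<Sum>t\<in>T. c t * h t) a = 0"
    proof (cases "a \<in> S")
      case False
      with a obtain i where "\<not> lookup a i \<le> 3 * n * D" by (auto simp: S_def)
      then have "a \<notin> keys (h t)" if "t \<in> T" for t using h[OF that] unfolding exps_le_def by blast
      then show ?thesis unfolding * by (simp add: in_keys_iff)
    qed (use * v in simp)
  qed
  also have "(\<Sum>t\<in>T. c t * h t) = (\<Sum>i<n. (\<Sum>j<n. (\<Sum>k<n. c (i, j, k) * f3 ^ k) * f2 ^ j) * f1 ^ i)"
    unfolding T_def h_def by (simp add: sum.cartesian_product' sum_distrib_right mult.assoc)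
  finally have F: "(\<Sum>i<n. (\<Sum>j<n. (\<Sum>k<n. c (i, j, k) * f3 ^ k) * f2 ^ j) * f1 ^ i) \<in> mono_ideal U" .
  \<comment> \<open>Successive minimisation finds the lexicographically first index with a nonzero
    coefficient. Everything before it vanishes, so the powers with exponents \<open>i\<close>,
    \<open>j\<close>, \<open>k\<close> factor out layer by layer.\<close>
  define i where "i = (LEAST i. i < n \<and> (\<exists>j<n. \<exists>k<n. v (i, j, k) \<noteq> 0))"
  have "\<exists>i. i < n \<and> (\<exists>j<n. \<exists>k<n. v (i, j, k) \<noteq> 0)" using v(1) by (auto simp: T_def)
  from LeastI_ex[OF this] have i: "i < n" "\<exists>j. j < n \<and> (\<exists>k<n. v (i, j, k) \<noteq> 0)" unfolding i_def by auto
  have i': "v (i', j, k) = 0" if "i' < i" "j < n" "k < n" for i' j k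
    using not_less_Least[OF that(1)[unfolded i_def]] that i(1) by auto
  define j where "j = (LEAST j. j < n \<and> (\<exists>k<n. v (i, j, k) \<noteq> 0))"
  from LeastI_ex[OF i(2)] have j: "j < n" "\<exists>k. k < n \<and> v (i, j, k) \<noteq> 0" unfolding j_def by auto
  have j': "v (i, j', k) = 0" if "j' < j" "k < n" for j' k
    using not_less_Least[OF that(1)[unfolded j_def]] that j(1) by auto
  define k where "k = (LEAST k. k < n \<and> v (i, j, k) \<noteq> 0)"
  from LeastI_ex[OF j(2)] have k: "k < n" "v (i, j, k) \<noteq> 0" unfolding k_def by auto
  have k': "v (i, j, k') = 0" if "k' < k" for k'
    using not_less_Least[OF that(1)[unfolded k_def]] that k(1) by auto
  obtain p where p: "(\<Sum>k<n. c (i, j, k) * f3 ^ k) = f3 ^ k * (c (i, j, k) + f3 * p)"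
    using sum_powers_lowest_term[OF k(1), of "\<lambda>k. c (i, j, k)" f3] k' by (auto simp: c_def)
  obtain q where q: "(\<Sum>j<n. (\<Sum>k<n. c (i, j, k) * f3 ^ k) * f2 ^ j) =
      f2 ^ j * ((\<Sum>k<n. c (i, j, k) * f3 ^ k) + f2 * q)"
    using sum_powers_lowest_term[OF j(1), of "\<lambda>j. \<Sum>k<n. c (i, j, k) * f3 ^ k" f2] j'
    by (auto simp: c_def)
  obtain s where s: "(\<Sum>i<n. (\<Sum>j<n. (\<Sum>k<n. c (i, j, k) * f3 ^ k) * f2 ^ j) * f1 ^ i) =
      f1 ^ i * ((\<Sum>j<n. (\<Sum>k<n. c (i, j, k) * f3 ^ k) * f2 ^ j) + f1 * s)"
    using sum_powers_lowest_term[OF i(1), of "\<lambda>i. \<Sum>j<n. (\<Sum>k<n. c (i, j, k) * f3 ^ k) * f2 ^ j" f1] i'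
    by (auto simp: c_def)
  have "f1 ^ i * (f2 ^ j * (f3 ^ k * (Poly_Mapping.single 0 (v (i, j, k)) + f3 * p) + f2 * q) + f1 * s)
      \<in> mono_ideal U"
    using F[unfolded s, unfolded q, unfolded p] by (simp only: c_def)
  with k(2) show ?thesis by blast
qed

text \<open>Regularity cancels the powers of f1, f2, f3 one after the other, each modulo the
  preceding elements. What remains puts the nonzero constant \<open>r\<close> into the ideal
  generated by \<open>I\<close> and the sequence, which is proper.\<close>

lemma regular_seq_length_le_2:
  fixes I M :: "(('n::finite \<Rightarrow>\<^sub>0 nat) \<Rightarrow>\<^sub>0 'k::field) set"
  assumes I: "is_ideal I" and reg: "regular_seq_quot M I fs"
    and rel: "\<And>f1 f2 f3. \<exists>l m n r p q s. r \<noteq> 0 \<and>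
      f1 ^ l * (f2 ^ m * (f3 ^ n * (Poly_Mapping.single 0 r + f3 * p) + f2 * q) + f1 * s) \<in> I"
  shows "length fs \<le> 2"
proof (rule ccontr)
  assume "\<not> length fs \<le> 2"
  then obtain f1 f2 f3 gs where fs: "fs = f1 # f2 # f3 # gs"
    by (cases fs; cases "tl fs"; cases "tl (tl fs)") auto
  have R: "fs ! i ^ l * g \<in> ideal_gen (I \<union> set (take i fs)) \<Longrightarrow> g \<in> ideal_gen (I \<union> set (take i fs))"
    if "i < length fs" for i g l
  proof (induction l)
    case (Suc l)
    from Suc.prems have "fs ! i * (fs ! i ^ l * g) \<in> ideal_gen (I \<union> set (take i fs))"
      by (simp add: mult.assoc)
    then have "fs ! i ^ l * g \<in> ideal_gen (I \<union> set (take i fs))"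
      using reg that unfolding regular_seq_quot_def by blast
    then show ?case by (rule Suc.IH)
  qed simp
  define J where "J i = ideal_gen (I \<union> set (take i fs))" for i
  have R0: "f1 ^ l * g \<in> I \<Longrightarrow> g \<in> J 1" for g l
    using R[of 0 l g] ideal_gen_eq[OF I] ideal_gen_superset[of "I \<union> {f1}"] by (auto simp: fs J_def)
  have R1: "f2 ^ l * g \<in> J 1 \<Longrightarrow> g \<in> J 1" and R2: "f3 ^ l * g \<in> J 2 \<Longrightarrow> g \<in> J 2" for g l
    using R[of 1 l g] R[of 2 l g] by (auto simp: fs J_def)
  have J: "is_ideal (J i)" for i unfolding J_def by (rule is_ideal_ideal_gen)
  have J12: "J 1 \<subseteq> J 2" "J 2 \<subseteq> J 3"
    unfolding J_def fs by (auto simp: ideal_gen_def numeral_3_eq_3 numeral_2_eq_2)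
  have f: "f1 \<in> J 1" "f2 \<in> J 2" "f3 \<in> J 3"
    using ideal_gen_superset unfolding J_def fs numeral_3_eq_3 numeral_2_eq_2 by fastforce+
  obtain l m n r p q s where r: "r \<noteq> 0" and "f1 ^ l * (f2 ^ m * (f3 ^ n * (Poly_Mapping.single 0 r + f3 * p) + f2 * q) + f1 * s) \<in> I"
    using rel[of f1 f2 f3] by (elim exE conjE) (rule that)
  from R0[OF this(2)] have "f2 ^ m * (f3 ^ n * (Poly_Mapping.single 0 r + f3 * p) + f2 * q) \<in> J 1"
    by (simp only: is_ideal_add_cancel[OF J is_idealD(4)[OF J f(1)]])
  with R1 J12 have "f3 ^ n * (Poly_Mapping.single 0 r + f3 * p) + f2 * q \<in> J 2" by blast
  then have "f3 ^ n * (Poly_Mapping.single 0 r + f3 * p) \<in> J 2"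
    by (simp only: is_ideal_add_cancel[OF J is_idealD(4)[OF J f(2)]])
  with R2 J12 have "Poly_Mapping.single 0 r + f3 * p \<in> J 3" by blast
  then have "Poly_Mapping.single 0 r \<in> J 3"
    by (simp only: is_ideal_add_cancel[OF J is_idealD(4)[OF J f(3)]])
  then have "Poly_Mapping.single 0 (1 / r) * Poly_Mapping.single 0 r \<in> J 3" by (rule is_idealD[OF J])
  then have "1 \<in> J 3" using r by (simp add: mult_single)
  moreover have "J 3 \<subseteq> ideal_gen (I \<union> set fs)" using set_take_subset[of 3 fs] by (auto simp: J_def ideal_gen_def)
  ultimately show False using reg ideal_UNIV_iff[OF is_ideal_ideal_gen] unfolding regular_seq_quot_def by blast
qed

text \<open>Choose each f_i in the i-th prime but outside its predecessor. Primality now cancels the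
  powers in the relation, and the nonzero constant \<open>r\<close> ends up in the fourth prime of
  the chain.\<close>

lemma prime_chain_length_le_2:
  fixes I :: "(('n::finite \<Rightarrow>\<^sub>0 nat) \<Rightarrow>\<^sub>0 'k::field) set"
  assumes P: "\<And>i. i \<le> N \<Longrightarrow> is_prime_ideal (P i) \<and> I \<subseteq> P i" "\<And>i. i < N \<Longrightarrow> P i \<subset> P (Suc i)"
    and rel: "\<And>f1 f2 f3. \<exists>l m n r p q s. r \<noteq> 0 \<and>
      f1 ^ l * (f2 ^ m * (f3 ^ n * (Poly_Mapping.single 0 r + f3 * p) + f2 * q) + f1 * s) \<in> I"
  shows "N \<le> 2"
proof (rule ccontr)
  assume "\<not> N \<le> 2"
  then have N: "2 < N" by simp
  have J: "is_ideal (P i)" "1 \<notin> P i" if "i \<le> N" for i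
    using P(1)[OF that] ideal_UNIV_iff unfolding is_prime_ideal_def by auto
  have R: "g \<in> P i" if "i \<le> N" "f \<notin> P i" "f ^ l * g \<in> P i" for i f g l
    using that(3)
  proof (induction l)
    case (Suc l)
    then have "f * (f ^ l * g) \<in> P i" by (simp add: mult.assoc)
    then have "f ^ l * g \<in> P i" using P(1)[OF that(1)] that(2) unfolding is_prime_ideal_def by blast
    then show ?case by (rule Suc.IH)
  qed simp
  obtain f1 f2 f3 where f: "f1 \<in> P 1" "f1 \<notin> P 0" "f2 \<in> P 2" "f2 \<notin> P 1" "f3 \<in> P 3" "f3 \<notin> P 2"
    using P(2)[of 0] P(2)[of 1] P(2)[of 2] N by (auto simp: numeral_3_eq_3 numeral_2_eq_2)
  have sub: "P 0 \<subseteq> P 1" "P 1 \<subseteq> P 2" "P 2 \<subseteq> P 3"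
    using P(2)[of 0] P(2)[of 1] P(2)[of 2] N by (auto simp: numeral_3_eq_3 numeral_2_eq_2)
  obtain l m n r p q s where r: "r \<noteq> 0" and "f1 ^ l * (f2 ^ m * (f3 ^ n * (Poly_Mapping.single 0 r + f3 * p) + f2 * q) + f1 * s) \<in> I"
    using rel[of f1 f2 f3] by (elim exE conjE) (rule that)
  then have F: "f1 ^ l * (f2 ^ m * (f3 ^ n * (Poly_Mapping.single 0 r + f3 * p) + f2 * q) + f1 * s) \<in> P 0"
    using P(1)[of 0] by blast
  have le: "0 \<le> N" "1 \<le> N" "2 \<le> N" "3 \<le> N" using N by auto
  from R[OF le(1) f(2) F] sub have
    "f2 ^ m * (f3 ^ n * (Poly_Mapping.single 0 r + f3 * p) + f2 * q) + f1 * s \<in> P 1" by blast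
  then have "f2 ^ m * (f3 ^ n * (Poly_Mapping.single 0 r + f3 * p) + f2 * q) \<in> P 1"
    by (simp only: is_ideal_add_cancel[OF J(1)[OF le(2)] is_idealD(4)[OF J(1)[OF le(2)] f(1)]])
  from R[OF le(2) f(4) this] sub have "f3 ^ n * (Poly_Mapping.single 0 r + f3 * p) + f2 * q \<in> P 2"
    by blast
  then have "f3 ^ n * (Poly_Mapping.single 0 r + f3 * p) \<in> P 2"
    by (simp only: is_ideal_add_cancel[OF J(1)[OF le(3)] is_idealD(4)[OF J(1)[OF le(3)] f(3)]])
  from R[OF le(3) f(6) this] sub have "Poly_Mapping.single 0 r + f3 * p \<in> P 3" by blast
  then have "Poly_Mapping.single 0 r \<in> P 3"
    by (simp only: is_ideal_add_cancel[OF J(1)[OF le(4)] is_idealD(4)[OF J(1)[OF le(4)] f(5)]])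
  then have "Poly_Mapping.single 0 (1 / r) * Poly_Mapping.single 0 r \<in> P 3"
    by (intro is_idealD J) (use N in auto)
  then show False using r J(2)[of 3] N by (simp add: mult_single)
qed

section \<open>Edge ideals of weighted oriented pentagons\<close>

lemma card_monomials_below:
  fixes h :: "'n::finite \<Rightarrow> nat"
  shows "finite {a :: 'n \<Rightarrow>\<^sub>0 nat. \<forall>i. lookup a i < h i}"
    and "card {a :: 'n \<Rightarrow>\<^sub>0 nat. \<forall>i. lookup a i < h i} = (\<Prod>i\<in>UNIV. h i)"
proof -
  let ?A = "{a :: 'n \<Rightarrow>\<^sub>0 nat. \<forall>i. lookup a i < h i}"
  have "bij_betw lookup ?A (PiE UNIV (\<lambda>i. {..<h i}))"
  proof (rule bij_betw_byWitness[of _ Abs_poly_mapping])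
    show "lookup ` ?A \<subseteq> PiE UNIV (\<lambda>i. {..<h i})" by (auto simp: PiE_iff)
  qed (auto simp: PiE_iff)
  then show "finite ?A" "card ?A = (\<Prod>i\<in>UNIV. h i)"
    by (auto simp: bij_betw_finite finite_PiE bij_betw_same_card card_PiE)
qed

lemma all_5: "(\<forall>i::5. P i) \<longleftrightarrow> P 0 \<and> P 1 \<and> P 2 \<and> P 3 \<and> P 4"
  by (metis UNIV_5 UNIV_I empty_iff insert_iff)

lemma ex_5: "(\<exists>i::5. P i) \<longleftrightarrow> P 0 \<or> P 1 \<or> P 2 \<or> P 3 \<or> P 4"
  using all_5[of "\<lambda>i. \<not> P i"] by blast

text \<open>At most two exponents can be large at once, and this is where the dimension 2 comes
  from.\<close>

lemma independent_set_pentagon: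
  fixes q :: "5 \<Rightarrow> bool"
  assumes "\<And>i. \<not> (q i \<and> q (i + 1))"
  shows "\<exists>i. \<forall>j. q j \<longrightarrow> j = i \<or> j = i + 2"
proof -
  have "\<not> (q 0 \<and> q 1)" "\<not> (q 1 \<and> q 2)" "\<not> (q 2 \<and> q 3)" "\<not> (q 3 \<and> q 4)" "\<not> (q 4 \<and> q 0)"
    using assms[of 0] assms[of 1] assms[of 2] assms[of 3] assms[of 4] by (simp_all add: wrap_5)
  then show ?thesis unfolding ex_5 all_5 by (simp add: wrap_5) blast
qed

lemma edge_monosI: "(i, j) \<in> E \<Longrightarrow> 1 \<le> lookup a i \<Longrightarrow> w j \<le> lookup a j \<Longrightarrow> a \<in> edge_monos E w"
  by (auto simp: edge_monos_def)

definition pentagon :: "(5 \<Rightarrow> 5) \<Rightarrow> (5 \<times> 5) set \<Rightarrow> bool" where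
  "pentagon \<sigma> E \<longleftrightarrow> bij \<sigma> \<and> (\<forall>a b. (a, b) \<in> E \<or> (b, a) \<in> E \<longleftrightarrow> (\<exists>i. {a, b} = {\<sigma> i, \<sigma> (i + 1)}))"

lemma pentagon_edge: "pentagon \<sigma> E \<Longrightarrow> (\<sigma> i, \<sigma> (i + 1)) \<in> E \<or> (\<sigma> (i + 1), \<sigma> i) \<in> E"
  unfolding pentagon_def by blast

lemma pentagon_irrefl:
  assumes "pentagon \<sigma> E" shows "(i, i) \<notin> E"
proof
  assume "(i, i) \<in> E"
  then obtain j where "{i, i} = {\<sigma> j, \<sigma> (j + 1)}" using assms unfolding pentagon_def by meson
  then have "\<sigma> j = \<sigma> (j + 1)" by (auto simp: doubleton_eq_iff)
  then have "j = j + 1" using assms unfolding pentagon_def by (meson bij_is_inj injD)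
  then show False by simp
qed

text \<open>The vertices with exponent at least \<open>W\<close> are pairwise nonadjacent, hence lie
  in one of the five diagonals. The monomials outside the ideal are thus covered by five boxes, each
  with two sides \<open>B + 1\<close> and three sides \<open>W\<close>.\<close>

lemma card_standard_monomials:
  assumes P: "pentagon \<sigma> E"
  shows "\<exists>C. \<forall>B. finite {a. a \<notin> edge_monos E w \<and> (\<forall>i. lookup a i \<le> B)} \<and>
    card {a. a \<notin> edge_monos E w \<and> (\<forall>i. lookup a i \<le> B)} \<le> C * (B + 1)\<^sup>2"
proof -
  have bij: "bij \<sigma>" using P by (simp add: pentagon_def)
  \<comment> \<open>Positive and at least every weight: two adjacent exponents of size
    \<open>W\<close> force divisibility by the generator of the edge, whichever way it
    points.\<close>
  define W where "W = Suc (\<Sum>i\<in>UNIV. w i)"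
  have W: "w i \<le> W" for i using member_le_sum[of i UNIV w] by (simp add: W_def)
  have "finite {a. a \<notin> edge_monos E w \<and> (\<forall>i. lookup a i \<le> B)} \<and>
    card {a. a \<notin> edge_monos E w \<and> (\<forall>i. lookup a i \<le> B)} \<le> 5 * W ^ 3 * (B + 1)\<^sup>2" for B
  proof -
    let ?A = "{a. a \<notin> edge_monos E w \<and> (\<forall>i. lookup a i \<le> B)}"
    define h where "h i j = (if j \<in> {i, i + 2} then B + 1 else W)" for i j :: 5
    define A where "A i = {a. \<forall>j. lookup a j < h i (inv \<sigma> j)}" for i
    have "?A \<subseteq> (\<Union>i. A i)"
    proof
      fix a assume a: "a \<in> ?A"
      define q where "q i \<longleftrightarrow> W \<le> lookup a (\<sigma> i)" for i
      have "\<not> (q i \<and> q (i + 1))" for i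
        using a W[of "\<sigma> i"] W[of "\<sigma> (i + 1)"] pentagon_edge[OF P, of i]
        by (fastforce simp: q_def edge_monos_def W_def)
      from independent_set_pentagon[of q, OF this] obtain i where i: "\<forall>j. q j \<longrightarrow> j = i \<or> j = i + 2"
        by blast
      have "lookup a j < h i (inv \<sigma> j)" for j
      proof (cases "q (inv \<sigma> j)")
        case True
        then show ?thesis using i a by (auto simp: h_def less_Suc_eq_le)
      next
        case False
        then have "lookup a j < W" using bij by (simp add: q_def surj_f_inv_f bij_is_surj)
        moreover have "lookup a j < B + 1" using a by (simp add: less_Suc_eq_le)
        ultimately show ?thesis by (simp add: h_def)
      qed
      then show "a \<in> (\<Union>i. A i)" by (auto simp: A_def)
    qed
    moreover have fin: "finite (\<Union>i. A i)" unfolding A_def by (intro finite_UN_I card_monomials_below) auto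
    moreover have "card (\<Union>i. A i) \<le> (\<Sum>i\<in>UNIV. card (A i))" by (rule card_UN_le) simp
    moreover have "card (A i) = W ^ 3 * (B + 1)\<^sup>2" for i
    proof -
      have "card (A i) = (\<Prod>j\<in>UNIV. h i (inv \<sigma> j))" unfolding A_def by (rule card_monomials_below)
      also have "\<dots> = (\<Prod>j\<in>UNIV. h i j)"
        by (rule prod.reindex_bij_betw) (use bij bij_imp_bij_inv in blast)
      also have "\<dots> = W ^ 3 * (B + 1)\<^sup>2"
        unfolding UNIV_5_shift[of i] h_def by (simp add: power2_eq_square power3_eq_cube algebra_simps)
      finally show ?thesis .
    qed
    ultimately show ?thesis
      using finite_subset[of ?A "\<Union>i. A i"] card_mono[of "\<Union>i. A i" ?A] by simp
  qed
  then show ?thesis by blast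
qed

lemma edge_ideal_relation:
  fixes f1 f2 f3 :: "'k::field pol5"
  assumes P: "pentagon \<sigma> E"
  shows "\<exists>l m n r p q s. r \<noteq> 0 \<and>
    f1 ^ l * (f2 ^ m * (f3 ^ n * (Poly_Mapping.single 0 r + f3 * p) + f2 * q) + f1 * s) \<in> edge_ideal E w"
proof -
  obtain C where C: "\<And>B. finite {a. a \<notin> edge_monos E w \<and> (\<forall>i. lookup a i \<le> B)}"
    "\<And>B. card {a. a \<notin> edge_monos E w \<and> (\<forall>i. lookup a i \<le> B)} \<le> C * (B + 1)\<^sup>2"
    using card_standard_monomials[OF P, of w] by blast
  show ?thesis
    unfolding edge_ideal_eq_mono_ideal[OF pentagon_irrefl[OF P]]
    by (rule algebraic_relation_mod_mono_ideal[OF C])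
qed

section \<open>Primes generated by variables, the Krull dimension, and the Cohen-Macaulay
  criterion\<close>

lemma prime_mono_ideal:
  fixes U :: "('n::linorder \<Rightarrow>\<^sub>0 nat) set"
  assumes U: "up_closed U" "0 \<notin> U" and prime: "\<And>a b. a + b \<in> U \<Longrightarrow> a \<in> U \<or> b \<in> U"
  shows "is_prime_ideal (mono_ideal U :: (('n \<Rightarrow>\<^sub>0 nat) \<Rightarrow>\<^sub>0 'k::field) set)"
  unfolding is_prime_ideal_def
proof (intro conjI allI impI)
  let ?I = "mono_ideal U :: (('n \<Rightarrow>\<^sub>0 nat) \<Rightarrow>\<^sub>0 'k::field) set"
  show I: "is_ideal ?I" by (rule is_ideal_mono_ideal[OF U(1)])
  show "?I \<noteq> UNIV" unfolding ideal_UNIV_iff[OF I] using U(2) by (simp add: mono_ideal_def)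
  fix f g :: "('n \<Rightarrow>\<^sub>0 nat) \<Rightarrow>\<^sub>0 'k" assume fg: "f * g \<in> ?I"
  \<comment> \<open>Drop all terms in \<open>U\<close>. The complement of \<open>U\<close> is closed
    under addition, so the product of the reduced polynomials has no term in \<open>U\<close>; being
    also in the ideal, it is zero. The linear order on \<open>'n\<close> orders the monomials and
    makes the polynomial ring a domain, so one factor vanishes.\<close>
  define red where "red f = (\<Sum>a\<in>keys f - U. Poly_Mapping.single a (lookup f a))"
    for f :: "('n \<Rightarrow>\<^sub>0 nat) \<Rightarrow>\<^sub>0 'k"
  have red: "lookup (red f) a = (if a \<in> U then 0 else lookup f a)" for f a
    by (auto simp: red_def lookup_sum lookup_single when_def in_keys_iff)
  have diff: "f - red f \<in> ?I" for f by (simp add: mem_mono_ideal lookup_minus red)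
  have keys: "keys (red f) \<inter> U = {}" for f by (auto simp: in_keys_iff red)
  have "f * g - ((f - red f) * g + red f * (g - red g)) \<in> ?I"
    by (intro is_idealD(6)[OF I fg] is_idealD(2)[OF I] is_idealD(3)[OF I diff] is_idealD(4)[OF I diff])
  then have "red f * red g \<in> ?I" by (simp add: algebra_simps)
  moreover have "keys (red f * red g) \<inter> U = {}"
    using keys_mult[of "red f" "red g"] keys prime by fastforce
  ultimately have "keys (red f * red g) = {}" unfolding mono_ideal_def by blast
  then have "red f * red g = 0" by (simp add: poly_mapping_eqI not_in_keys_iff_lookup_eq_zero[symmetric])
  then have "red f = 0 \<or> red g = 0" by simp
  then show "f \<in> ?I \<or> g \<in> ?I" using diff[of f] diff[of g] by auto
qed

text \<open>The ideal generated by the variables indexed by \<open>C\<close>, given as a monomial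
  ideal so that \<open>prime_mono_ideal\<close> applies.\<close>

definition vars_prime :: "5 set \<Rightarrow> 'k::field pol5 set" where
  "vars_prime C = mono_ideal {a. \<exists>i\<in>C. lookup a i \<noteq> 0}"

lemma is_prime_ideal_vars_prime: "is_prime_ideal (vars_prime C :: 'k::field pol5 set)"
  unfolding vars_prime_def by (rule prime_mono_ideal) (auto simp: up_closed_def lookup_add)

lemma var_mem_vars_prime: "var i \<in> vars_prime C \<longleftrightarrow> i \<in> C"
  by (auto simp: vars_prime_def var_def lookup_single when_def)

lemma vars_prime_strict_mono:
  assumes "C \<subset> D" shows "(vars_prime C :: 'k::field pol5 set) \<subset> vars_prime D"
proof -
  obtain i where i: "i \<in> D" "i \<notin> C" using assms by blast
  have "vars_prime C \<subseteq> (vars_prime D :: 'k pol5 set)"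
    using assms unfolding vars_prime_def mono_ideal_def by blast
  then show ?thesis using i var_mem_vars_prime[of i C] var_mem_vars_prime[of i D] by blast
qed

lemma krull_dim_edge_ideal:
  assumes P: "pentagon \<sigma> E" and w: "\<And>v. 0 < w v"
  shows "krull_dim_quot (edge_ideal E w :: 'k::field pol5 set) = 2"
proof (rule antisym)
  let ?I = "edge_ideal E w :: 'k pol5 set"
  show "krull_dim_quot ?I \<le> 2"
    unfolding krull_dim_quot_def
  proof (rule Sup_least)
    fix d assume "d \<in> {enat n | n. \<exists>P :: nat \<Rightarrow> 'k pol5 set.
      (\<forall>i\<le>n. is_prime_ideal (P i) \<and> ?I \<subseteq> P i) \<and> (\<forall>i<n. P i \<subset> P (Suc i))}"
    then obtain n Q where n: "d = enat n" and
      Q: "\<And>i. i \<le> n \<Longrightarrow> is_prime_ideal (Q i) \<and> ?I \<subseteq> Q i" "\<And>i. i < n \<Longrightarrow> Q i \<subset> Q (Suc i)"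
      by auto
    have "n \<le> 2" by (rule prime_chain_length_le_2[where P = Q and I = ?I, OF Q edge_ideal_relation[OF P]])
    then show "d \<le> 2" by (simp add: n numeral_eq_enat)
  qed
  \<comment> \<open>The positions 1, 3, 4 form a vertex cover of the cycle, since 0 and 2 are not
    adjacent; hence the variables there generate a prime over the edge ideal. Adding the two missing
    vertices one at a time gives a chain of length two.\<close>
  define C :: "nat \<Rightarrow> 5 set" where "C n = \<sigma> ` (if n = 0 then {1, 3, 4} else if n = 1 then {0, 1, 3, 4} else UNIV)" for n
  have inj: "inj \<sigma>" using P by (simp add: pentagon_def bij_is_inj)
  have "?I \<subseteq> vars_prime (C n)" for n
  proof -
    have "\<sigma> ` {1, 3, 4} \<subseteq> C n" by (auto simp: C_def)
    have cover: "i \<in> C n \<or> j \<in> C n" if ij: "(i, j) \<in> E" for i j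
    proof -
      obtain k where k: "{i, j} = {\<sigma> k, \<sigma> (k + 1)}" using ij P unfolding pentagon_def by blast
      have "k \<in> {1, 3, 4} \<or> k + 1 \<in> {1, 3, 4}" using UNIV_5 by (cases "k = 0"; cases "k = 2") auto
      then have "\<sigma> k \<in> C n \<or> \<sigma> (k + 1) \<in> C n" using \<open>\<sigma> ` {1, 3, 4} \<subseteq> C n\<close> by blast
      then show ?thesis using k by (auto simp: doubleton_eq_iff)
    qed
    have "edge_monos E w \<subseteq> {a. \<exists>i\<in>C n. lookup a i \<noteq> 0}"
    proof
      fix a assume "a \<in> edge_monos E w"
      then obtain i j where ij: "(i, j) \<in> E" "1 \<le> lookup a i" "w j \<le> lookup a j"
        by (auto simp: edge_monos_def)
      then have "lookup a i \<noteq> 0" "lookup a j \<noteq> 0" using w[of j] by linarith+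
      then show "a \<in> {a. \<exists>i\<in>C n. lookup a i \<noteq> 0}" using cover[OF ij(1)] by blast
    qed
    then show ?thesis
      unfolding edge_ideal_eq_mono_ideal[OF pentagon_irrefl[OF P]] vars_prime_def mono_ideal_def by blast
  qed
  moreover have "vars_prime (C i) \<subset> (vars_prime (C (Suc i)) :: 'k pol5 set)" if "i < 2" for i
  proof (rule vars_prime_strict_mono)
    have "{1, 3, 4} \<subset> {0, 1, 3, 4 :: 5}" "{0, 1, 3, 4} \<subset> (UNIV :: 5 set)"
      unfolding UNIV_5 psubset_eq set_eq_iff
      by (auto intro: exI[of _ 0] exI[of _ 2])
    then have "\<sigma> ` {1, 3, 4} \<subset> \<sigma> ` {0, 1, 3, 4}" "\<sigma> ` {0, 1, 3, 4} \<subset> \<sigma> ` UNIV"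
      by (simp_all only: image_strict_mono[OF inj_on_subset[OF inj subset_UNIV]])
    moreover have "i = 0 \<or> i = 1" using that by auto
    ultimately show "C i \<subset> C (Suc i)" unfolding C_def by (elim disjE) simp_all
  qed
  ultimately have "\<exists>P. (\<forall>i\<le>2. is_prime_ideal (P i) \<and> ?I \<subseteq> P i) \<and> (\<forall>i<2. P i \<subset> P (Suc i))"
    by (intro exI[of _ "\<lambda>i. vars_prime (C i)"]) (simp add: is_prime_ideal_vars_prime)
  then have "enat 2 \<le> krull_dim_quot ?I"
    unfolding krull_dim_quot_def by (intro Sup_upper CollectI exI[of _ 2] conjI refl)
  then show "2 \<le> krull_dim_quot ?I" by (simp add: numeral_eq_enat)
qed

theorem cohen_macaulay_iff_mono_vanishing:
  assumes P: "pentagon \<sigma> E" and w: "\<And>v. 0 < w v"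
  shows "cohen_macaulay_quot (edge_ideal E w :: 'k::field pol5 set) \<longleftrightarrow> mono_vanishing (edge_monos E w)"
proof -
  let ?I = "edge_ideal E w :: 'k pol5 set"
  note I_eq = edge_ideal_eq_mono_ideal[OF pentagon_irrefl[OF P], of w, where ?'k = 'k]
  note U = up_closed_edge_monos[of E w]
  have I: "is_ideal ?I" unfolding edge_ideal_def by (rule is_ideal_ideal_gen)
  have le: "length fs \<le> 2" if "regular_seq_quot max_ideal ?I fs" for fs
    by (rule regular_seq_length_le_2[OF I that edge_ideal_relation[OF P]])
  have depth_le: "depth_quot max_ideal ?I \<le> 2"
    unfolding depth_quot_def by (rule Sup_least) (auto simp: numeral_eq_enat dest: le)
  have "depth_quot max_ideal ?I = 2 \<longleftrightarrow> mono_vanishing (edge_monos E w)"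
  proof
    assume d: "depth_quot max_ideal ?I = 2"
    have "\<exists>fs. regular_seq_quot max_ideal ?I fs \<and> 2 \<le> length fs"
    proof (rule ccontr)
      assume "\<not> ?thesis"
      then have "length fs \<le> 1" if "regular_seq_quot max_ideal ?I fs" for fs
        using that by force
      then have "depth_quot max_ideal ?I \<le> 1"
        unfolding depth_quot_def by (intro Sup_least) (auto simp: one_enat_def)
      then show False using d by simp
    qed
    then show "mono_vanishing (edge_monos E w)"
      using regular_seq_imp_vanishing[OF I] unfolding max_ideal_def
      by (metis I_eq mono_vanishing_iff[OF U])
  next
    assume C: "mono_vanishing (edge_monos E w)"
    \<comment> \<open>Large enough for both exponents in the \<open>W\<close>-th power of an edge
      product to reach the weights.\<close>
    define W where "W = Suc (\<Sum>i\<in>UNIV. w i)"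
    have W: "w i \<le> W" for i using member_le_sum[of i UNIV w] by (simp add: W_def)
    have "regular_seq_quot max_ideal (mono_ideal (edge_monos E w) :: 'k pol5 set)
      [(\<Sum>i\<in>UNIV. var i), (\<Sum>i\<in>UNIV. var (\<sigma> i) * var (\<sigma> (i + 2)))]"
    proof (rule regular_seq_two[OF U])
      show "0 \<notin> edge_monos E w" by (auto simp: edge_monos_def)
      show bij: "bij \<sigma>" using P by (simp add: pentagon_def)
      fix i
      have "(var (\<sigma> i) * var (\<sigma> (i + 1))) ^ W \<in> (mono_ideal (edge_monos E w) :: 'k pol5 set)"
      proof -
        have "1 \<le> W" by (simp add: W_def)
        then have "Poly_Mapping.single (\<sigma> i) W + Poly_Mapping.single (\<sigma> (i + 1)) W \<in> edge_monos E w"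
          using pentagon_edge[OF P, of i] W[of "\<sigma> i"] W[of "\<sigma> (i + 1)"]
          by (elim disjE) (erule edge_monosI; simp add: lookup_add lookup_single when_def)+
        then show ?thesis unfolding power_mult_distrib var_power mult_single by simp
      qed
      then show "\<exists>n. (var (\<sigma> i) * var (\<sigma> (i + 1))) ^ n \<in> (mono_ideal (edge_monos E w) :: 'k pol5 set)" ..
    qed (use C mono_vanishing_iff[OF U] in blast)+
    then have "enat 2 \<le> depth_quot max_ideal ?I"
      unfolding depth_quot_def I_eq
      by (intro Sup_upper CollectI exI[of _ "[(\<Sum>i\<in>UNIV. var i), (\<Sum>i\<in>UNIV. var (\<sigma> i) * var (\<sigma> (i + 2)))]"])
        (simp add: numeral_2_eq_2)
    then show "depth_quot max_ideal ?I = 2" using depth_le by (simp add: numeral_eq_enat)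
  qed
  then show ?thesis unfolding cohen_macaulay_quot_def krull_dim_edge_ideal[of \<sigma> E w, OF P w] .
qed

section \<open>The finite check\<close>

definition divides :: "(5 \<Rightarrow> bool) \<Rightarrow> (5 \<Rightarrow> bool) \<Rightarrow> (5 \<Rightarrow> bool) \<Rightarrow> bool" where
  "divides d p q \<longleftrightarrow> (\<exists>i. if d i then p i \<and> q (i + 1) else p (i + 1) \<and> q i)"

text \<open>Here \<open>d i\<close> says that the edge between \<open>i\<close> and \<open>i + 1\<close> points to \<open>i + 1\<close>, and \<open>p\<close>, \<open>q\<close>, \<open>r\<close> stand for
  \<open>1 \<le> a\<close>, \<open>w \<le> a\<close> and \<open>w \<le> a + 1\<close> at each vertex, so that multiplying \<open>x\<^sup>a\<close> by the variable at \<open>i\<close>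
  sets \<open>p i\<close> to \<open>True\<close> and \<open>q i\<close> to \<open>r i\<close>. Below, \<open>t i\<close> says that the weight at \<open>i\<close> is one.\<close>

definition vanishing_at :: "(5 \<Rightarrow> bool) \<Rightarrow> (5 \<Rightarrow> bool) \<Rightarrow> (5 \<Rightarrow> bool) \<Rightarrow> (5 \<Rightarrow> bool) \<Rightarrow> bool" where
  "vanishing_at d p q r \<longleftrightarrow> (\<not> divides d p q \<longrightarrow>
    (\<exists>i. \<not> divides d (p(i := True)) (q(i := r i))) \<and>
    (\<forall>i. \<not> p i \<longrightarrow> (\<exists>j. j \<noteq> i \<and> \<not> divides d (p(j := True)) (q(j := r j)))) \<and>
    (\<forall>X. (\<exists>i. X i \<and> \<not> divides d (p(i := True)) (q(i := r i))) \<and>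
         (\<exists>j. \<not> X j \<and> \<not> divides d (p(j := True)) (q(j := r j))) \<longrightarrow>
       (\<exists>i j. X i \<and> \<not> X j \<and> \<not> divides d (p(j := True, i := True)) (q(j := r j, i := r i)))))"

text \<open>The symmetries are the rotations c + i and the reflections c - i. A reflection carries
  the edge between i and i + 1 to the one between c - i - 1 and c - i and traverses it backwards,
  hence the shifted index and the negation.\<close>

definition dihedral :: "((5 \<Rightarrow> bool) \<Rightarrow> (5 \<Rightarrow> bool) \<Rightarrow> bool) \<Rightarrow> (5 \<Rightarrow> bool) \<Rightarrow> (5 \<Rightarrow> bool) \<Rightarrow> bool" where
  "dihedral T d t \<longleftrightarrow> (\<exists>c. T (\<lambda>i. d (c + i)) (\<lambda>i. t (c + i)) \<or> T (\<lambda>i. \<not> d (c - i - 1)) (\<lambda>i. t (c - i)))"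

definition "D1 d t \<longleftrightarrow> \<not> d 2 \<and> d 3 \<and> \<not> d 1 \<and> d 4 \<and> t 0 \<and> t 1 \<and> t 3 \<and> \<not> t 2 \<and> \<not> t (4::5)"
definition "D2 d t \<longleftrightarrow> \<not> d 2 \<and> \<not> d 3 \<and> \<not> d 4 \<and> t 0 \<and> t 1 \<and> t 2 \<and> \<not> t 3 \<and> \<not> t (4::5)"
definition "D3 d t \<longleftrightarrow> \<not> d 2 \<and> \<not> d 3 \<and> \<not> d 4 \<and> t 0 \<and> t 1 \<and> \<not> t 2 \<and> \<not> t 3 \<and> \<not> t (4::5)"
definition "D4 d t \<longleftrightarrow> \<not> d 2 \<and> d 3 \<and> d 1 \<and> d 0 \<and> t 0 \<and> t 3 \<and> \<not> t 1 \<and> \<not> t 2 \<and> \<not> t (4::5)"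

definition "cm_type d t \<longleftrightarrow> dihedral D4 d t \<or> ((\<exists>i. t i \<and> t (i + 1)) \<and>
   \<not> dihedral D1 d t \<and> \<not> dihedral D2 d t \<and> \<not> dihedral D3 d t)"

lemma arith_5: "(0::5) + i = i" "(0::5) - i = - i"
  "(1 + 1 :: 5) = 2" "(2 + 1 :: 5) = 3" "(3 + 1 :: 5) = 4" "(4 + 1 :: 5) = 0"
  "(1 + 2 :: 5) = 3" "(2 + 2 :: 5) = 4" "(3 + 2 :: 5) = 0" "(4 + 2 :: 5) = 1"
  "(1 + 3 :: 5) = 4" "(2 + 3 :: 5) = 0" "(3 + 3 :: 5) = 1" "(4 + 3 :: 5) = 2"
  "(1 + 4 :: 5) = 0" "(2 + 4 :: 5) = 1" "(3 + 4 :: 5) = 2" "(4 + 4 :: 5) = 3"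
  "(1 - 1 :: 5) = 0" "(2 - 1 :: 5) = 1" "(3 - 1 :: 5) = 2" "(4 - 1 :: 5) = 3"
  "(1 - 2 :: 5) = 4" "(2 - 2 :: 5) = 0" "(3 - 2 :: 5) = 1" "(4 - 2 :: 5) = 2"
  "(1 - 3 :: 5) = 3" "(2 - 3 :: 5) = 4" "(3 - 3 :: 5) = 0" "(4 - 3 :: 5) = 1"
  "(1 - 4 :: 5) = 2" "(2 - 4 :: 5) = 3" "(3 - 4 :: 5) = 4" "(4 - 4 :: 5) = 0"
  "i - 0 = (i :: 5)" "i + 0 = (i :: 5)"
  "(- 1 :: 5) = 4" "(- 2 :: 5) = 3" "(- 3 :: 5) = 2" "(- 4 :: 5) = 1" "(- 0 :: 5) = 0"
  by simp_all

lemma distinct_5: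
  "(0 :: 5) \<noteq> 1" "(0 :: 5) \<noteq> 2" "(0 :: 5) \<noteq> 3" "(0 :: 5) \<noteq> 4"
  "(1 :: 5) \<noteq> 0" "(1 :: 5) \<noteq> 2" "(1 :: 5) \<noteq> 3" "(1 :: 5) \<noteq> 4"
  "(2 :: 5) \<noteq> 0" "(2 :: 5) \<noteq> 1" "(2 :: 5) \<noteq> 3" "(2 :: 5) \<noteq> 4"
  "(3 :: 5) \<noteq> 0" "(3 :: 5) \<noteq> 1" "(3 :: 5) \<noteq> 2" "(3 :: 5) \<noteq> 4"
  "(4 :: 5) \<noteq> 0" "(4 :: 5) \<noteq> 1" "(4 :: 5) \<noteq> 2" "(4 :: 5) \<noteq> 3"
  by simp_all

text \<open>It suffices to test the monomials \<open>x\<^sup>a\<close> with \<open>a = w - 1\<close> at all vertices, or at all but one where \<open>a = 0\<close>,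
  and to separate a single vertex from the others.\<close>

lemma vanishing_imp_cm_type:
  assumes s: "\<forall>i. d (i + 1) \<and> \<not> d i \<longrightarrow> t (i + 1)"
  and 1: "vanishing_at d (\<lambda>i. \<not> t i) (\<lambda>_. False) (\<lambda>_. True)"
  and 2: "\<forall>k. vanishing_at d (\<lambda>i. i \<noteq> k \<and> \<not> t i) (\<lambda>_. False) (\<lambda>i. i = k \<longrightarrow> t i)"
  shows "cm_type d t"
proof -
  \<comment> \<open>Specialising the set \<open>X\<close> to one vertex \<open>m\<close> removes the
    second-order quantifier.\<close>
  have v: "\<not> divides d p q \<longrightarrow> (\<forall>m. \<not> divides d (p(m := True)) (q(m := r m)) \<longrightarrow>
       (\<exists>j. j \<noteq> m \<and> \<not> divides d (p(j := True)) (q(j := r j))) \<longrightarrow>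
       (\<exists>j. j \<noteq> m \<and> \<not> divides d (p(j := True, m := True)) (q(j := r j, m := r m))))"
    if "vanishing_at d p q r" for p q r
  proof (intro allI impI)
    fix m assume "\<not> divides d p q" "\<not> divides d (p(m := True)) (q(m := r m))"
      "\<exists>j. j \<noteq> m \<and> \<not> divides d (p(j := True)) (q(j := r j))"
    then show "\<exists>j. j \<noteq> m \<and> \<not> divides d (p(j := True, m := True)) (q(j := r j, m := r m))"
      using that unfolding vanishing_at_def by (auto dest!: spec[where x = "\<lambda>i. i = m"])
  qed
  have 2: "\<forall>k. \<not> divides d (\<lambda>i. i \<noteq> k \<and> \<not> t i) (\<lambda>_. False) \<longrightarrow> (\<forall>m.
     \<not> divides d ((\<lambda>i. i \<noteq> k \<and> \<not> t i)(m := True)) ((\<lambda>_. False)(m := m = k \<longrightarrow> t m)) \<longrightarrow>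
       (\<exists>j. j \<noteq> m \<and> \<not> divides d ((\<lambda>i. i \<noteq> k \<and> \<not> t i)(j := True)) ((\<lambda>_. False)(j := j = k \<longrightarrow> t j))) \<longrightarrow>
       (\<exists>j. j \<noteq> m \<and> \<not> divides d ((\<lambda>i. i \<noteq> k \<and> \<not> t i)(j := True, m := True)) ((\<lambda>_. False)(j := j = k \<longrightarrow> t j, m := m = k \<longrightarrow> t m))))"
    using 2 v by blast
  \<comment> \<open>Listing the five vertices leaves a propositional problem in the ten atoms
    \<open>d i\<close> and \<open>t i\<close>.\<close>
  show ?thesis
    using s v[OF 1] 2
    unfolding cm_type_def dihedral_def D1_def D2_def D3_def D4_def divides_def
    by (simp only: ex_5 all_5 arith_5 distinct_5 fun_upd_apply if_True if_False simp_thms if_bool_eq_conj) satx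
qed

text \<open>The assumption \<open>s\<close> is the weight convention: both edges at i + 1 point away
  from it, so it is a source. The assumption \<open>c\<close> collects relations between 1 <= a, w
  <= a, w <= a + 1 and w = 1 that hold for every natural a and positive w. Proving the claim for all
  truth values subject to them covers the infinitely many exponent vectors.\<close>

lemma cm_type_imp_vanishing:
  assumes s: "\<forall>i. d (i + 1) \<and> \<not> d i \<longrightarrow> t (i + 1)"
  and c: "\<forall>i. (q i \<longrightarrow> p i \<and> r i) \<and> (t i \<longrightarrow> r i \<and> (p i \<longrightarrow> q i)) \<and> (\<not> p i \<and> \<not> t i \<longrightarrow> \<not> r i)"
  and "cm_type d t"
  shows "vanishing_at d p q r"
  unfolding vanishing_at_def
proof (intro impI conjI allI)
  assume n: "\<not> divides d p q"
  show "\<exists>i. \<not> divides d (p(i := True)) (q(i := r i))"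
    using n assms
    unfolding cm_type_def dihedral_def D1_def D2_def D3_def D4_def divides_def
    by (simp only: ex_5 all_5 arith_5 distinct_5 fun_upd_apply if_True if_False simp_thms if_bool_eq_conj) satx
  have "\<forall>i. \<not> p i \<longrightarrow> (\<exists>j. j \<noteq> i \<and> \<not> divides d (p(j := True)) (q(j := r j)))"
    using n assms
    unfolding cm_type_def dihedral_def D1_def D2_def D3_def D4_def divides_def
    by (simp only: ex_5 all_5 arith_5 distinct_5 fun_upd_apply if_True if_False simp_thms if_bool_eq_conj) satx
  then show "\<exists>j. j \<noteq> i \<and> \<not> divides d (p(j := True)) (q(j := r j))" if "\<not> p i" for i
    using that by blast
  \<comment> \<open>With \<open>X\<close> fixed but arbitrary, its five values are further atoms, so
    all subsets are treated in one propositional problem.\<close>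
  show "(\<exists>i. X i \<and> \<not> divides d (p(i := True)) (q(i := r i))) \<and>
         (\<exists>j. \<not> X j \<and> \<not> divides d (p(j := True)) (q(j := r j))) \<Longrightarrow>
       (\<exists>i j. X i \<and> \<not> X j \<and> \<not> divides d (p(j := True, i := True)) (q(j := r j, i := r i)))" for X
    using n assms
    unfolding cm_type_def dihedral_def D1_def D2_def D3_def D4_def divides_def
    by (simp only: ex_5 all_5 arith_5 distinct_5 fun_upd_apply if_True if_False simp_thms if_bool_eq_conj) satx
qed

section \<open>From the edge ideal to truth values along the cycle\<close>

definition dir :: "(5 \<Rightarrow> 5) \<Rightarrow> (5 \<times> 5) set \<Rightarrow> 5 \<Rightarrow> bool" where
  "dir \<sigma> E i \<longleftrightarrow> (\<sigma> i, \<sigma> (i + 1)) \<in> E"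

lemma dir_reverse:
  assumes "pentagon \<sigma> E" "\<forall>a b. (a, b) \<in> E \<longrightarrow> (b, a) \<notin> E"
  shows "(\<sigma> (i + 1), \<sigma> i) \<in> E \<longleftrightarrow> \<not> dir \<sigma> E i"
  using pentagon_edge[OF assms(1), of i] assms(2) by (auto simp: dir_def)

lemma edge_monos_iff_divides:
  assumes P: "pentagon \<sigma> E" and anti: "\<forall>a b. (a, b) \<in> E \<longrightarrow> (b, a) \<notin> E"
  shows "a \<in> edge_monos E w \<longleftrightarrow>
    divides (dir \<sigma> E) (\<lambda>i. 1 \<le> lookup a (\<sigma> i)) (\<lambda>i. w (\<sigma> i) \<le> lookup a (\<sigma> i))"
proof
  assume "a \<in> edge_monos E w"
  then obtain x y where xy: "(x, y) \<in> E" "1 \<le> lookup a x" "w y \<le> lookup a y"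
    by (auto simp: edge_monos_def)
  then obtain i where "{x, y} = {\<sigma> i, \<sigma> (i + 1)}" using P unfolding pentagon_def by blast
  then show "divides (dir \<sigma> E) (\<lambda>i. 1 \<le> lookup a (\<sigma> i)) (\<lambda>i. w (\<sigma> i) \<le> lookup a (\<sigma> i))"
    using xy anti unfolding divides_def dir_def
    by (intro exI[of _ i]) (auto simp: doubleton_eq_iff)
next
  assume "divides (dir \<sigma> E) (\<lambda>i. 1 \<le> lookup a (\<sigma> i)) (\<lambda>i. w (\<sigma> i) \<le> lookup a (\<sigma> i))"
  then obtain i where i: "if dir \<sigma> E i then 1 \<le> lookup a (\<sigma> i) \<and> w (\<sigma> (i + 1)) \<le> lookup a (\<sigma> (i + 1))
      else 1 \<le> lookup a (\<sigma> (i + 1)) \<and> w (\<sigma> i) \<le> lookup a (\<sigma> i)"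
    unfolding divides_def by blast
  show "a \<in> edge_monos E w"
  proof (cases "dir \<sigma> E i")
    case True
    with i show ?thesis unfolding dir_def by (intro edge_monosI[of "\<sigma> i" "\<sigma> (i + 1)"]) auto
  next
    case False
    with i show ?thesis using dir_reverse[OF P anti, of i]
      by (intro edge_monosI[of "\<sigma> (i + 1)" "\<sigma> i"]) auto
  qed
qed

lemma mono_vanishing_iff_vanishing_at:
  assumes P: "pentagon \<sigma> E" and anti: "\<forall>a b. (a, b) \<in> E \<longrightarrow> (b, a) \<notin> E"
  shows "mono_vanishing (edge_monos E w) \<longleftrightarrow> (\<forall>a. vanishing_at (dir \<sigma> E) (\<lambda>i. 1 \<le> lookup a (\<sigma> i))
    (\<lambda>i. w (\<sigma> i) \<le> lookup a (\<sigma> i)) (\<lambda>i. w (\<sigma> i) \<le> Suc (lookup a (\<sigma> i))))"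
proof -
  have bij: "bij \<sigma>" using P by (simp add: pentagon_def)
  have inj [simp]: "\<sigma> i = \<sigma> j \<longleftrightarrow> i = j" for i j using bij by (simp add: bij_is_inj inj_eq)
  have all: "(\<forall>i. Q i) \<longleftrightarrow> (\<forall>k. Q (\<sigma> k))" for Q :: "5 \<Rightarrow> bool"
    by (metis bij bij_pointE)
  have ex: "(\<exists>i. Q i) \<longleftrightarrow> (\<exists>k. Q (\<sigma> k))" for Q :: "5 \<Rightarrow> bool"
    using all[of "\<lambda>i. \<not> Q i"] by blast
  \<comment> \<open>Sets of vertices become predicates on positions along the cycle.\<close>
  have sets: "(\<forall>X :: 5 set. Q X) \<longleftrightarrow> (\<forall>Y. Q {x. Y (inv \<sigma> x)})" for Q
  proof (intro iffI allI)
    fix X assume "\<forall>Y. Q {x. Y (inv \<sigma> x)}"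
    then have "Q {x. \<sigma> (inv \<sigma> x) \<in> X}" by (rule spec)
    then show "Q X" using bij by (simp add: bij_is_surj surj_f_inv_f)
  qed blast
  have inv [simp]: "inv \<sigma> (\<sigma> k) = k" for k using bij by (simp add: bij_is_inj)
  note edge = edge_monos_iff_divides[of \<sigma> E _ w, OF P anti]
  have p: "(\<lambda>i. 1 \<le> lookup (pow (\<sigma> k) + b) (\<sigma> i)) = (\<lambda>i. 1 \<le> lookup b (\<sigma> i))(k := True)" for k b
    by (auto simp: fun_eq_iff lookup_add lookup_single when_def)
  have q: "(\<lambda>i. w (\<sigma> i) \<le> lookup (pow (\<sigma> k) + b) (\<sigma> i)) =
      (\<lambda>i. w (\<sigma> i) \<le> lookup b (\<sigma> i))(k := w (\<sigma> k) \<le> Suc (lookup b (\<sigma> k)))" for k b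
    by (auto simp: fun_eq_iff lookup_add lookup_single when_def)
  have zero: "\<not> 1 \<le> n \<longleftrightarrow> n = 0" for n :: nat by auto
  \<comment> \<open>The vertices \<open>i\<close> and \<open>j\<close> differ because
    \<open>X\<close> separates them. No exponent is therefore raised twice, and w <= a + 1 is the
    furthest comparison ever needed.\<close>
  have two: "(\<exists>i j. X i \<and> \<not> X j \<and> pow (\<sigma> i) + (pow (\<sigma> j) + a) \<notin> edge_monos E w) \<longleftrightarrow>
    (\<exists>i j. X i \<and> \<not> X j \<and> \<not> divides (dir \<sigma> E)
       ((\<lambda>i. 1 \<le> lookup a (\<sigma> i))(j := True, i := True))
       ((\<lambda>i. w (\<sigma> i) \<le> lookup a (\<sigma> i))(j := w (\<sigma> j) \<le> Suc (lookup a (\<sigma> j)), i := w (\<sigma> i) \<le> Suc (lookup a (\<sigma> i)))))"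
    for X a
  proof (intro ex_cong1 conj_cong refl)
    fix i j assume "X i" "\<not> X j"
    then have "lookup (pow (\<sigma> j) + a) (\<sigma> i) = lookup a (\<sigma> i)"
      by (auto simp: lookup_add lookup_single when_def)
    then show "pow (\<sigma> i) + (pow (\<sigma> j) + a) \<notin> edge_monos E w \<longleftrightarrow> \<not> divides (dir \<sigma> E)
       ((\<lambda>i. 1 \<le> lookup a (\<sigma> i))(j := True, i := True))
       ((\<lambda>i. w (\<sigma> i) \<le> lookup a (\<sigma> i))(j := w (\<sigma> j) \<le> Suc (lookup a (\<sigma> j)), i := w (\<sigma> i) \<le> Suc (lookup a (\<sigma> i))))"
      by (simp only: edge p q)
  qed
  have c1: "(\<exists>i. pow i + a \<notin> edge_monos E w) \<longleftrightarrow> (\<exists>i. pow (\<sigma> i) + a \<notin> edge_monos E w)" for a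
    by (rule ex)
  have c2: "(\<forall>i. lookup a i = 0 \<longrightarrow> (\<exists>j. j \<noteq> i \<and> pow j + a \<notin> edge_monos E w)) \<longleftrightarrow>
      (\<forall>i. lookup a (\<sigma> i) = 0 \<longrightarrow> (\<exists>j. j \<noteq> i \<and> pow (\<sigma> j) + a \<notin> edge_monos E w))" for a
  proof -
    have "(\<exists>j. j \<noteq> \<sigma> i \<and> pow j + a \<notin> edge_monos E w) \<longleftrightarrow> (\<exists>j. j \<noteq> i \<and> pow (\<sigma> j) + a \<notin> edge_monos E w)" for i
      using ex[of "\<lambda>j. j \<noteq> \<sigma> i \<and> pow j + a \<notin> edge_monos E w"] by simp
    then show ?thesis
      using all[of "\<lambda>i. lookup a i = 0 \<longrightarrow> (\<exists>j. j \<noteq> i \<and> pow j + a \<notin> edge_monos E w)"] by simp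
  qed
  have c3: "(\<forall>X. (\<exists>i\<in>X. pow i + a \<notin> edge_monos E w) \<and> (\<exists>j\<in>-X. pow j + a \<notin> edge_monos E w) \<longrightarrow>
        (\<exists>i\<in>X. \<exists>j\<in>-X. pow i + (pow j + a) \<notin> edge_monos E w)) \<longleftrightarrow>
      (\<forall>X. (\<exists>i. X i \<and> pow (\<sigma> i) + a \<notin> edge_monos E w) \<and> (\<exists>j. \<not> X j \<and> pow (\<sigma> j) + a \<notin> edge_monos E w) \<longrightarrow>
          (\<exists>i j. X i \<and> \<not> X j \<and> pow (\<sigma> i) + (pow (\<sigma> j) + a) \<notin> edge_monos E w))" for a
  proof -
    have "(\<exists>i\<in>{x. Y (inv \<sigma> x)}. R i) \<longleftrightarrow> (\<exists>i. Y i \<and> R (\<sigma> i))"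
      "(\<exists>i\<in>-{x. Y (inv \<sigma> x)}. R i) \<longleftrightarrow> (\<exists>i. \<not> Y i \<and> R (\<sigma> i))" for Y R
      using ex[of "\<lambda>i. Y (inv \<sigma> i) \<and> R i"] ex[of "\<lambda>i. \<not> Y (inv \<sigma> i) \<and> R i"]
      by (simp_all add: Bex_def)
    then show ?thesis unfolding sets by (simp only: ex_simps)
  qed
  have "mono_vanishing (edge_monos E w) \<longleftrightarrow> (\<forall>a. a \<notin> edge_monos E w \<longrightarrow>
     (\<exists>i. pow (\<sigma> i) + a \<notin> edge_monos E w) \<and>
     (\<forall>i. lookup a (\<sigma> i) = 0 \<longrightarrow> (\<exists>j. j \<noteq> i \<and> pow (\<sigma> j) + a \<notin> edge_monos E w)) \<and>
     (\<forall>X. (\<exists>i. X i \<and> pow (\<sigma> i) + a \<notin> edge_monos E w) \<and> (\<exists>j. \<not> X j \<and> pow (\<sigma> j) + a \<notin> edge_monos E w) \<longrightarrow>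
          (\<exists>i j. X i \<and> \<not> X j \<and> pow (\<sigma> i) + (pow (\<sigma> j) + a) \<notin> edge_monos E w)))"
    unfolding mono_vanishing_def c1 c2 c3 ..
  also have "\<dots> \<longleftrightarrow> (\<forall>a. vanishing_at (dir \<sigma> E) (\<lambda>i. 1 \<le> lookup a (\<sigma> i))
    (\<lambda>i. w (\<sigma> i) \<le> lookup a (\<sigma> i)) (\<lambda>i. w (\<sigma> i) \<le> Suc (lookup a (\<sigma> i))))"
    unfolding two by (simp only: vanishing_at_def edge p q zero)
  finally show ?thesis .
qed

lemma mono_vanishing_iff_cm_type:
  assumes P: "pentagon \<sigma> E" and anti: "\<forall>a b. (a, b) \<in> E \<longrightarrow> (b, a) \<notin> E"
    and w: "\<And>v. 0 < w v" and src: "\<And>v. is_source E v \<Longrightarrow> w v = 1"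
  shows "mono_vanishing (edge_monos E w) \<longleftrightarrow> cm_type (dir \<sigma> E) (\<lambda>i. w (\<sigma> i) = 1)"
proof -
  have inj [simp]: "\<sigma> i = \<sigma> j \<longleftrightarrow> i = j" for i j using P by (simp add: pentagon_def bij_is_inj inj_eq)
  \<comment> \<open>Each edge at position i + 1 joins it to i or i + 2, and both point away from it,
    so it is a source.\<close>
  have s: "\<forall>i. dir \<sigma> E (i + 1) \<and> \<not> dir \<sigma> E i \<longrightarrow> w (\<sigma> (i + 1)) = 1"
  proof (intro allI impI)
    fix i assume i: "dir \<sigma> E (i + 1) \<and> \<not> dir \<sigma> E i"
    have "(u, \<sigma> (i + 1)) \<notin> E" for u
    proof
      assume u: "(u, \<sigma> (i + 1)) \<in> E"
      then obtain j where j: "{u, \<sigma> (i + 1)} = {\<sigma> j, \<sigma> (j + 1)}" using P unfolding pentagon_def by blast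
      then consider "u = \<sigma> j" "j = i" | "u = \<sigma> (j + 1)" "j = i + 1"
        by (auto simp: doubleton_eq_iff)
      then show False using u i anti by cases (auto simp: dir_def)
    qed
    then show "w (\<sigma> (i + 1)) = 1" using src by (simp add: is_source_def)
  qed
  show ?thesis
    unfolding mono_vanishing_iff_vanishing_at[of \<sigma> E w, OF P anti]
  proof
    assume V: "\<forall>a. vanishing_at (dir \<sigma> E) (\<lambda>i. 1 \<le> lookup a (\<sigma> i))
      (\<lambda>i. w (\<sigma> i) \<le> lookup a (\<sigma> i)) (\<lambda>i. w (\<sigma> i) \<le> Suc (lookup a (\<sigma> i)))"
    have V: "vanishing_at (dir \<sigma> E) (\<lambda>i. 1 \<le> f (\<sigma> i)) (\<lambda>i. w (\<sigma> i) \<le> f (\<sigma> i)) (\<lambda>i. w (\<sigma> i) \<le> Suc (f (\<sigma> i)))" for f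
      using V[rule_format, of "Abs_poly_mapping f"] by simp
    have w1: "1 \<le> w v - 1 \<longleftrightarrow> w v \<noteq> 1" "\<not> w v \<le> w v - 1" "w v \<le> Suc (w v - 1)" "\<not> w v \<le> 0"
      "w v \<le> Suc 0 \<longleftrightarrow> w v = 1" for v using w[of v] by auto
    show "cm_type (dir \<sigma> E) (\<lambda>i. w (\<sigma> i) = 1)"
    proof (rule vanishing_imp_cm_type[where t = "\<lambda>i. w (\<sigma> i) = 1", OF s])
      show "vanishing_at (dir \<sigma> E) (\<lambda>i. \<not> w (\<sigma> i) = 1) (\<lambda>_. False) (\<lambda>_. True)"
        using V[of "\<lambda>v. w v - 1"] by (simp only: w1)
      have "vanishing_at (dir \<sigma> E) (\<lambda>i. i \<noteq> k \<and> \<not> w (\<sigma> i) = 1) (\<lambda>_. False) (\<lambda>i. i = k \<longrightarrow> w (\<sigma> i) = 1)" for k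
      proof -
        let ?f = "\<lambda>v. if v = \<sigma> k then 0 else w v - 1"
        have "(\<lambda>i. 1 \<le> ?f (\<sigma> i)) = (\<lambda>i. i \<noteq> k \<and> \<not> w (\<sigma> i) = 1)"
          "(\<lambda>i. w (\<sigma> i) \<le> ?f (\<sigma> i)) = (\<lambda>_. False)"
          "(\<lambda>i. w (\<sigma> i) \<le> Suc (?f (\<sigma> i))) = (\<lambda>i. i = k \<longrightarrow> w (\<sigma> i) = 1)"
          using w1 by (auto simp: fun_eq_iff)
        then show ?thesis using V[of ?f] by simp
      qed
      then show "\<forall>k. vanishing_at (dir \<sigma> E) (\<lambda>i. i \<noteq> k \<and> \<not> w (\<sigma> i) = 1) (\<lambda>_. False) (\<lambda>i. i = k \<longrightarrow> w (\<sigma> i) = 1)"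
        by blast
    qed
  next
    assume C: "cm_type (dir \<sigma> E) (\<lambda>i. w (\<sigma> i) = 1)"
    show "\<forall>a. vanishing_at (dir \<sigma> E) (\<lambda>i. 1 \<le> lookup a (\<sigma> i))
      (\<lambda>i. w (\<sigma> i) \<le> lookup a (\<sigma> i)) (\<lambda>i. w (\<sigma> i) \<le> Suc (lookup a (\<sigma> i)))"
    proof
      fix a
      have "\<forall>i. (w (\<sigma> i) \<le> lookup a (\<sigma> i) \<longrightarrow> 1 \<le> lookup a (\<sigma> i) \<and> w (\<sigma> i) \<le> Suc (lookup a (\<sigma> i))) \<and>
        (w (\<sigma> i) = 1 \<longrightarrow> w (\<sigma> i) \<le> Suc (lookup a (\<sigma> i)) \<and> (1 \<le> lookup a (\<sigma> i) \<longrightarrow> w (\<sigma> i) \<le> lookup a (\<sigma> i))) \<and>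
        (\<not> 1 \<le> lookup a (\<sigma> i) \<and> \<not> w (\<sigma> i) = 1 \<longrightarrow> \<not> w (\<sigma> i) \<le> Suc (lookup a (\<sigma> i)))"
        using w by (auto simp: Suc_le_eq intro: less_le_trans dest: le_SucE)
      from cm_type_imp_vanishing[where t = "\<lambda>i. w (\<sigma> i) = 1", OF s this C]
      show "vanishing_at (dir \<sigma> E) (\<lambda>i. 1 \<le> lookup a (\<sigma> i))
        (\<lambda>i. w (\<sigma> i) \<le> lookup a (\<sigma> i)) (\<lambda>i. w (\<sigma> i) \<le> Suc (lookup a (\<sigma> i)))" .
    qed
  qed
qed

section \<open>Isomorphisms of weighted oriented pentagons\<close>

lemma pentagon_automorphism:
  fixes \<delta> :: "5 \<Rightarrow> 5"
  assumes inj: "inj \<delta>" and adj: "\<And>x. \<delta> (x + 1) = \<delta> x + 1 \<or> \<delta> x = \<delta> (x + 1) + 1"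
  shows "(\<exists>c. \<forall>x. \<delta> x = c + x) \<or> (\<exists>c. \<forall>x. \<delta> x = c - x)"
proof -
  \<comment> \<open>Injectivity forbids turning back, so the direction of the first step persists
    around the cycle and decides between rotation and reflection.\<close>
  have ne: "\<delta> (x + 2) \<noteq> \<delta> x" for x using inj_eq[OF inj, of "x + 2" x] by simp
  have up: "\<delta> (x + 2) = \<delta> x + 2" if "\<delta> (x + 1) = \<delta> x + 1" for x
    using adj[of "x + 1"] that ne[of x] by (auto simp: add.assoc)
  have down: "\<delta> (x + 2) = \<delta> x - 2" if "\<delta> x = \<delta> (x + 1) + 1" for x
    using adj[of "x + 1"] that ne[of x] by (auto simp: add.assoc algebra_simps)
  from adj[of 0] show ?thesis
  proof
    assume 0: "\<delta> (0 + 1) = \<delta> 0 + 1"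
    then have 2: "\<delta> 2 = \<delta> 0 + 2" using up[of 0] by simp
    then have 3: "\<delta> 3 = \<delta> 0 + 3" using up[of 1] 0 by (simp add: add.assoc)
    then have 4: "\<delta> 4 = \<delta> 0 + 4" using up[of 2] 2 by (simp add: add.assoc)
    from 0 2 3 4 have "\<forall>x. \<delta> x = \<delta> 0 + x" unfolding all_5 by simp
    then show ?thesis by blast
  next
    assume 0: "\<delta> 0 = \<delta> (0 + 1) + 1"
    then have 1: "\<delta> 1 = \<delta> 0 - 1" by simp
    have 2: "\<delta> 2 = \<delta> 0 - 2" using down[of 0] 0 by simp
    have 3: "\<delta> 3 = \<delta> 0 - 3" using down[of 1] 1 2 by (simp add: algebra_simps)
    have 4: "\<delta> 4 = \<delta> 0 - 4" using down[of 2] 2 3 by (simp add: algebra_simps)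
    from 1 2 3 4 have "\<forall>x. \<delta> x = \<delta> 0 - x" unfolding all_5 by simp
    then show ?thesis by blast
  qed
qed

definition pull :: "(5 \<Rightarrow> 5) \<Rightarrow> (5 \<times> 5) set \<Rightarrow> (5 \<times> 5) set" where
  "pull g E = {(a, b). (g a, g b) \<in> E}"

lemma pentagon_comp:
  assumes P: "pentagon \<sigma> E" and \<delta>: "\<delta> = (\<lambda>i. c + i) \<or> \<delta> = (\<lambda>i. c - i)"
  shows "pentagon (\<lambda>i. \<sigma> (\<delta> i)) E"
proof -
  have "bij (\<lambda>i :: 5. c + i)" "bij (\<lambda>i :: 5. c - i)"
    by (rule bij_betw_byWitness[of _ "\<lambda>i. i - c"]; simp)
      (rule bij_betw_byWitness[of _ "\<lambda>i. c - i"]; simp)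
  then have "bij (\<sigma> \<circ> \<delta>)" using \<delta> P unfolding pentagon_def by (auto intro: bij_comp)
  then have bij: "bij (\<lambda>i. \<sigma> (\<delta> i))" by (simp only: comp_def)
  have adj: "(\<exists>i. {a, b} = {\<sigma> (\<delta> i), \<sigma> (\<delta> (i + 1))}) \<longleftrightarrow> (\<exists>i. {a, b} = {\<sigma> i, \<sigma> (i + 1)})" for a b
    using \<delta>
  proof
    assume "\<delta> = (\<lambda>i. c + i)"
    then have "\<delta> (i + 1) = \<delta> i + 1" "\<delta> (i - c) = i" for i by (simp_all add: add.assoc)
    then show ?thesis by metis
  next
    assume "\<delta> = (\<lambda>i. c - i)"
    then have \<delta>: "\<delta> i = \<delta> (i + 1) + 1" "\<delta> (c - i - 1) = i + 1" "\<delta> (c - i - 1 + 1) = i" for i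
      by simp_all
    show ?thesis
    proof
      assume "\<exists>i. {a, b} = {\<sigma> (\<delta> i), \<sigma> (\<delta> (i + 1))}"
      then obtain i where "{a, b} = {\<sigma> (\<delta> (i + 1)), \<sigma> (\<delta> i)}" by (auto simp: insert_commute)
      then show "\<exists>i. {a, b} = {\<sigma> i, \<sigma> (i + 1)}" unfolding \<delta>(1)[of i] by blast
    next
      assume "\<exists>i. {a, b} = {\<sigma> i, \<sigma> (i + 1)}"
      then obtain i where "{a, b} = {\<sigma> (i + 1), \<sigma> i}" by (auto simp: insert_commute)
      then have "{a, b} = {\<sigma> (\<delta> (c - i - 1)), \<sigma> (\<delta> (c - i - 1 + 1))}" by (simp only: \<delta>(2,3))
      then show "\<exists>i. {a, b} = {\<sigma> (\<delta> i), \<sigma> (\<delta> (i + 1))}" by blast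
    qed
  qed
  have "(a, b) \<in> E \<or> (b, a) \<in> E \<longleftrightarrow> (\<exists>i. {a, b} = {\<sigma> i, \<sigma> (i + 1)})" for a b
    using P unfolding pentagon_def by blast
  then show ?thesis unfolding pentagon_def by (simp only: bij adj simp_thms)
qed

lemma std_pull:
  assumes P: "pentagon g E" and anti: "\<forall>a b. (a, b) \<in> E \<longrightarrow> (b, a) \<notin> E"
  shows "std_C5_orientation (pull g E)"
proof -
  have inj [simp]: "g i = g j \<longleftrightarrow> i = j" for i j using P by (simp add: pentagon_def bij_is_inj inj_eq)
  have "(a, b) \<in> pull g E \<or> (b, a) \<in> pull g E \<longleftrightarrow> b = a + 1 \<or> a = b + 1" for a b
  proof -
    have "(a, b) \<in> pull g E \<or> (b, a) \<in> pull g E \<longleftrightarrow> (\<exists>i. {g a, g b} = {g i, g (i + 1)})"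
      unfolding pull_def mem_Collect_eq prod.case using P unfolding pentagon_def by blast
    also have "\<dots> \<longleftrightarrow> (\<exists>i. a = i \<and> b = i + 1 \<or> a = i + 1 \<and> b = i)"
      by (simp only: doubleton_eq_iff inj)
    also have "\<dots> \<longleftrightarrow> b = a + 1 \<or> a = b + 1" by blast
    finally show ?thesis .
  qed
  moreover have "(a, b) \<in> pull g E \<Longrightarrow> (b, a) \<notin> pull g E" for a b using anti by (simp add: pull_def)
  ultimately show ?thesis unfolding std_C5_orientation_def by blast
qed

text \<open>An isomorphism onto a graph on the standard cycle, compared with the numbering
  \<open>\<sigma>\<close>, gives an automorphism \<open>\<delta>\<close> of the pentagon, hence a
  rotation or a reflection. The search over all graphs and isomorphisms reduces to ten
  renumberings.\<close>

lemma iso_to_type_iff_pull: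
  assumes P: "pentagon \<sigma> E"
    and std: "\<forall>E' w'. T E' w' \<longrightarrow> std_C5_orientation E'"
  shows "iso_to_type T E w \<longleftrightarrow> (\<exists>c. T (pull (\<lambda>i. \<sigma> (c + i)) E) (\<lambda>i. w (\<sigma> (c + i))) \<or>
    T (pull (\<lambda>i. \<sigma> (c - i)) E) (\<lambda>i. w (\<sigma> (c - i))))"
proof
  have iso: "iso_to_type T E w" if "pentagon g E" "T (pull g E) (\<lambda>i. w (g i))" for g
  proof -
    have g: "bij g" "g (inv g x) = x" for x
      using that(1) by (simp_all add: pentagon_def bij_is_surj surj_f_inv_f)
    then have "wog_iso E w (pull g E) (\<lambda>i. w (g i))"
      unfolding wog_iso_def pull_def by (intro exI[of _ "inv g"]) (simp add: bij_imp_bij_inv)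
    then show ?thesis using that(2) unfolding iso_to_type_def by blast
  qed
  assume "\<exists>c. T (pull (\<lambda>i. \<sigma> (c + i)) E) (\<lambda>i. w (\<sigma> (c + i))) \<or>
    T (pull (\<lambda>i. \<sigma> (c - i)) E) (\<lambda>i. w (\<sigma> (c - i)))"
  then show "iso_to_type T E w"
  proof (elim exE disjE)
    fix c
    assume "T (pull (\<lambda>i. \<sigma> (c + i)) E) (\<lambda>i. w (\<sigma> (c + i)))"
    with pentagon_comp[OF P, of "\<lambda>i. c + i" c] show ?thesis by (intro iso) auto
  next
    fix c
    assume "T (pull (\<lambda>i. \<sigma> (c - i)) E) (\<lambda>i. w (\<sigma> (c - i)))"
    with pentagon_comp[OF P, of "\<lambda>i. c - i" c] show ?thesis by (intro iso) auto
  qed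
next
  assume "iso_to_type T E w"
  then obtain E' w' f where T: "T E' w'" and f: "bij f" "\<And>a b. (a, b) \<in> E \<longleftrightarrow> (f a, f b) \<in> E'"
    "\<And>v. w' (f v) = w v"
    unfolding iso_to_type_def wog_iso_def by blast
  define g where "g = inv f"
  have fg: "f (g x) = x" for x using f(1) by (simp add: g_def bij_is_surj surj_f_inv_f)
  have E': "E' = pull g E" and w': "w' = (\<lambda>i. w (g i))"
    by (auto simp: pull_def f(2) fg fun_eq_iff simp flip: f(3))
  have bij: "bij \<sigma>" using P by (simp add: pentagon_def)
  define \<delta> where "\<delta> x = inv \<sigma> (g x)" for x
  have \<sigma>\<delta>: "\<sigma> (\<delta> x) = g x" for x using bij by (simp add: \<delta>_def bij_is_surj surj_f_inv_f)
  have inj: "\<sigma> i = \<sigma> j \<longleftrightarrow> i = j" for i j using bij by (simp add: bij_is_inj inj_eq)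
  have "inj \<delta>" by (rule injI) (metis \<sigma>\<delta> fg)
  moreover have "\<delta> (x + 1) = \<delta> x + 1 \<or> \<delta> x = \<delta> (x + 1) + 1" for x
  proof -
    have "(x, x + 1) \<in> E' \<or> (x + 1, x) \<in> E'" using std T unfolding std_C5_orientation_def by blast
    then have "(\<sigma> (\<delta> x), \<sigma> (\<delta> (x + 1))) \<in> E \<or> (\<sigma> (\<delta> (x + 1)), \<sigma> (\<delta> x)) \<in> E"
      by (simp add: E' pull_def \<sigma>\<delta>)
    then obtain i where "{\<sigma> (\<delta> x), \<sigma> (\<delta> (x + 1))} = {\<sigma> i, \<sigma> (i + 1)}"
      using P unfolding pentagon_def by blast
    then show ?thesis by (auto simp: doubleton_eq_iff inj)
  qed
  ultimately consider c where "\<delta> = (\<lambda>x. c + x)" | c where "\<delta> = (\<lambda>x. c - x)"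
    using pentagon_automorphism[of \<delta>] by blast
  moreover have "g = (\<lambda>x. \<sigma> (\<delta> x))" by (simp add: \<sigma>\<delta>)
  ultimately show "\<exists>c. T (pull (\<lambda>i. \<sigma> (c + i)) E) (\<lambda>i. w (\<sigma> (c + i))) \<or>
    T (pull (\<lambda>i. \<sigma> (c - i)) E) (\<lambda>i. w (\<sigma> (c - i)))"
    using T unfolding E' w' by cases auto
qed

lemma types_pull:
  assumes "pentagon g E" "\<forall>a b. (a, b) \<in> E \<longrightarrow> (b, a) \<notin> E"
  shows "typeD1 (pull g E) (\<lambda>i. w (g i)) \<longleftrightarrow> D1 (dir g E) (\<lambda>i. w (g i) = 1)"
    and "typeD2 (pull g E) (\<lambda>i. w (g i)) \<longleftrightarrow> D2 (dir g E) (\<lambda>i. w (g i) = 1)"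
    and "typeD3 (pull g E) (\<lambda>i. w (g i)) \<longleftrightarrow> D3 (dir g E) (\<lambda>i. w (g i) = 1)"
    and "typeD4 (pull g E) (\<lambda>i. w (g i)) \<longleftrightarrow> D4 (dir g E) (\<lambda>i. w (g i) = 1)"
proof -
  have fwd: "(i, i + 1) \<in> pull g E \<longleftrightarrow> dir g E i" for i by (simp add: pull_def dir_def)
  have bwd: "(i + 1, i) \<in> pull g E \<longleftrightarrow> \<not> dir g E i" for i
    using dir_reverse[OF assms, of i] by (simp add: pull_def)
  have edges: "(0, 1) \<in> pull g E \<longleftrightarrow> dir g E 0" "(1, 2) \<in> pull g E \<longleftrightarrow> dir g E 1"
    "(3, 4) \<in> pull g E \<longleftrightarrow> dir g E 3" "(4, 0) \<in> pull g E \<longleftrightarrow> dir g E 4"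
    "(2, 1) \<in> pull g E \<longleftrightarrow> \<not> dir g E 1" "(3, 2) \<in> pull g E \<longleftrightarrow> \<not> dir g E 2"
    "(4, 3) \<in> pull g E \<longleftrightarrow> \<not> dir g E 3" "(0, 4) \<in> pull g E \<longleftrightarrow> \<not> dir g E 4"
    using fwd[of 0] fwd[of 1] fwd[of 3] fwd[of 4] bwd[of 1] bwd[of 2] bwd[of 3] bwd[of 4]
    by (simp_all only: arith_5)
  show "typeD1 (pull g E) (\<lambda>i. w (g i)) \<longleftrightarrow> D1 (dir g E) (\<lambda>i. w (g i) = 1)"
    "typeD2 (pull g E) (\<lambda>i. w (g i)) \<longleftrightarrow> D2 (dir g E) (\<lambda>i. w (g i) = 1)"
    "typeD3 (pull g E) (\<lambda>i. w (g i)) \<longleftrightarrow> D3 (dir g E) (\<lambda>i. w (g i) = 1)"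
    "typeD4 (pull g E) (\<lambda>i. w (g i)) \<longleftrightarrow> D4 (dir g E) (\<lambda>i. w (g i) = 1)"
    using std_pull[OF assms]
    unfolding typeD1_def typeD2_def typeD3_def typeD4_def D1_def D2_def D3_def D4_def edges by blast+
qed

text \<open>The four types see the weights only through the question whether they equal one, so
  after renumbering each is a condition \<open>D\<close> on truth values.\<close>

lemma iso_to_type_iff_dihedral:
  assumes P: "pentagon \<sigma> E" and anti: "\<forall>a b. (a, b) \<in> E \<longrightarrow> (b, a) \<notin> E"
    and std: "\<forall>E' w'. T E' w' \<longrightarrow> std_C5_orientation E'"
    and T: "\<forall>g. pentagon g E \<longrightarrow> (T (pull g E) (\<lambda>i. w (g i)) \<longleftrightarrow> D (dir g E) (\<lambda>i. w (g i) = 1))"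
  shows "iso_to_type T E w \<longleftrightarrow> dihedral D (dir \<sigma> E) (\<lambda>i. w (\<sigma> i) = 1)"
proof -
  have "dir (\<lambda>i. \<sigma> (c + i)) E = (\<lambda>i. dir \<sigma> E (c + i))" for c
    by (simp add: dir_def fun_eq_iff add.assoc)
  moreover have "dir (\<lambda>i. \<sigma> (c - i)) E = (\<lambda>i. \<not> dir \<sigma> E (c - i - 1))" for c
  proof
    fix i
    show "dir (\<lambda>i. \<sigma> (c - i)) E i \<longleftrightarrow> \<not> dir \<sigma> E (c - i - 1)"
      using dir_reverse[OF P anti, of "c - i - 1"] by (simp add: dir_def diff_diff_eq)
  qed
  moreover have "pentagon (\<lambda>i. \<sigma> (c + i)) E" "pentagon (\<lambda>i. \<sigma> (c - i)) E" for c
    using pentagon_comp[OF P, of "\<lambda>i. c + i" c] pentagon_comp[OF P, of "\<lambda>i. c - i" c] by simp_all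
  ultimately show ?thesis
    unfolding iso_to_type_iff_pull[where T = T, OF P std] dihedral_def by (simp only: T)
qed

theorem theorem4p5:
  fixes E :: "(5 \<times> 5) set" and w :: "5 \<Rightarrow> nat"
  assumes "weighted_oriented_C5 E w"
  shows "cohen_macaulay_quot (edge_ideal E w :: 'k::field pol5 set) \<longleftrightarrow>
           (iso_to_type typeD4 E w \<or>
            ((\<exists>x y. (x, y) \<in> E \<and> w x = 1 \<and> w y = 1) \<and>
             \<not> iso_to_type typeD1 E w \<and> \<not> iso_to_type typeD2 E w \<and> \<not> iso_to_type typeD3 E w))"
proof -
  obtain \<sigma> where P: "pentagon \<sigma> E"
    using assms unfolding weighted_oriented_C5_def pentagon_def by blast
  have anti: "\<forall>a b. (a, b) \<in> E \<longrightarrow> (b, a) \<notin> E" and w: "\<And>v. 0 < w v" and src: "\<And>v. is_source E v \<Longrightarrow> w v = 1"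
    using assms unfolding weighted_oriented_C5_def by auto
  have "(\<exists>x y. (x, y) \<in> E \<and> w x = 1 \<and> w y = 1) \<longleftrightarrow> (\<exists>i. w (\<sigma> i) = 1 \<and> w (\<sigma> (i + 1)) = 1)"
  proof
    assume "\<exists>x y. (x, y) \<in> E \<and> w x = 1 \<and> w y = 1"
    then obtain x y where xy: "(x, y) \<in> E" "w x = 1" "w y = 1" by blast
    then obtain i where "{x, y} = {\<sigma> i, \<sigma> (i + 1)}" using P unfolding pentagon_def by blast
    then show "\<exists>i. w (\<sigma> i) = 1 \<and> w (\<sigma> (i + 1)) = 1"
      using xy by (intro exI[of _ i]) (auto simp: doubleton_eq_iff)
  next
    assume "\<exists>i. w (\<sigma> i) = 1 \<and> w (\<sigma> (i + 1)) = 1"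
    then show "\<exists>x y. (x, y) \<in> E \<and> w x = 1 \<and> w y = 1" using pentagon_edge[OF P] by blast
  qed
  moreover have "iso_to_type typeD1 E w \<longleftrightarrow> dihedral D1 (dir \<sigma> E) (\<lambda>i. w (\<sigma> i) = 1)"
    by (intro iso_to_type_iff_dihedral[OF P anti] allI impI types_pull(1)[OF _ anti]) (simp_all add: typeD1_def)
  moreover have "iso_to_type typeD2 E w \<longleftrightarrow> dihedral D2 (dir \<sigma> E) (\<lambda>i. w (\<sigma> i) = 1)"
    by (intro iso_to_type_iff_dihedral[OF P anti] allI impI types_pull(2)[OF _ anti]) (simp_all add: typeD2_def)
  moreover have "iso_to_type typeD3 E w \<longleftrightarrow> dihedral D3 (dir \<sigma> E) (\<lambda>i. w (\<sigma> i) = 1)"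
    by (intro iso_to_type_iff_dihedral[OF P anti] allI impI types_pull(3)[OF _ anti]) (simp_all add: typeD3_def)
  moreover have "iso_to_type typeD4 E w \<longleftrightarrow> dihedral D4 (dir \<sigma> E) (\<lambda>i. w (\<sigma> i) = 1)"
    by (intro iso_to_type_iff_dihedral[OF P anti] allI impI types_pull(4)[OF _ anti]) (simp_all add: typeD4_def)
  moreover have "cohen_macaulay_quot (edge_ideal E w :: 'k pol5 set) \<longleftrightarrow>
      cm_type (dir \<sigma> E) (\<lambda>i. w (\<sigma> i) = 1)"
    unfolding cohen_macaulay_iff_mono_vanishing[of \<sigma> E w, OF P w]
    by (rule mono_vanishing_iff_cm_type[of \<sigma> E w, OF P anti w src])
  ultimately show ?thesis unfolding cm_type_def by simp
qed

end
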